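(* There is an absolute constant $C_0>0$ (independent of all problem parameters) such that the following holds. Let $F_1,\dots,F_n:\mathbb{R}^d\to\mathbb{R}$ satisfy, for every $i$: $0\le F_i(w)\le B$ for all $w\in\mathbb{R}^d$; $F_i$ is $G$-Lipschitz; and $F_i$ is continuously differentiable with $L$-Lipschitz gradient (where $B,G,L>0$). Let $\theta\in(0,1)$, $1\le m\le n$, and let the regularization parameter be $\lambda=0$. Fix the number of local steps $\tau\ge 1$ and the number of rounds $T\ge 1$, fix $\mu=2L$, and set the learning rate $$\gamma=\min\left\{\frac{1}{4\tau L},\ \frac{1}{\tau\sqrt{T}}\sqrt{\frac{\Delta F_0}{LG^2}},\ \frac{1}{\tau T^{1/3}}\left(\frac{\Delta F_0}{32L^2G^2(1-\tau^{-1})}\right)^{1/3}\right\},$$ where $\Delta F_0=\overline\Phi_\theta^\mu(w^{(0)})-\inf\overline\Phi_\theta^\mu\ \le\ \overline F_\theta(w^{(0)})-\inf\overline F_\theta$ (and the third term in the minimum is read as $+\infty$ if $\tau=1$). Let $w^{(0)},\dots,w^{(T-1)}$ be the iterates of the algorithm described in the context with $\lambda=0$, and let $\hat w$ be sampled uniformly at random from $\{w^{(0)},\dots,w^{(T-1)}\}$. Then $$\mathbb{E}\left\|\nabla\overline\Phi_\theta^\mu(\hat w)\right\|^2\le C_0\left[\sqrt{\frac{\Delta F_0\,LG^2}{T}}+\left(\frac{\Delta F_0\,LG\,(1-\tau^{-1})^{1/2}}{T}\right)^{2/3}+\frac{\Delta F_0\,L}{T}\right].$$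
   Context: $\|\cdot\|$ is the Euclidean norm. For $S\subset[n]=\{1,\dots,n\}$ with $|S|=m$, let $\mathcal{P}_{\theta,S}=\{\pi=(\pi_i)_{i\in S}:\ \pi_i\ge 0,\ \sum_{i\in S}\pi_i=1,\ \pi_i\le \frac{1}{\theta m}\ \forall i\in S\}$. With $\lambda=0$, define $F_{\theta,S}(w)=\max_{\pi\in\mathcal{P}_{\theta,S}}\sum_{i\in S}\pi_iF_i(w)$ and $\overline F_\theta(w)=\mathbb{E}_{S\sim U_m}[F_{\theta,S}(w)]$, where $U_m$ is the uniform distribution over subsets of $[n]$ of size $m$. Moreau envelope: for $\mu>L$, $\overline\Phi_\theta^\mu(w)=\inf_{z\in\mathbb{R}^d}\{\overline F_\theta(z)+\frac{\mu}{2}\|w-z\|^2\}$; for such $\mu$ it is continuously differentiable. Algorithm (with regularization parameter $\lambda\ge 0$, step size $\gamma$, $\tau$ local steps): start from a given deterministic $w^{(0)}\in\mathbb{R}^d$. In each round $t=0,1,\dots,T-1$: sample $S\sim U_m$ independently of the past; choose $\pi^{(t)}\in\arg\max_{\pi\in\mathcal{P}_{\theta,S}}\sum_{i\in S}\pi_iF_i(w^{(t)})$; for each $i\in S$ set $w^{(t)}_{i,0}=w^{(t)}$ and, for $k=0,\dots,\tau-1$, $w^{(t)}_{i,k+1}=(1-\gamma\lambda)w^{(t)}_{i,k}-\gamma\nabla F_i(w^{(t)}_{i,k})$; finally set $w^{(t+1)}=\sum_{i\in S}\pi^{(t)}_iw^{(t)}_{i,\tau}$. The expectation in the claim is over the client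 sampling and the draw of $\hat w$. *)

theory Defs
  imports "HOL-Probability.Probability"
begin

(* The claim is about a constant that does not depend on the dimension d, so d has to be a number
   quantified inside the formula, not a type. All the spaces R^d are therefore taken inside one real
   inner product space: the finitely supported real sequences with the Euclidean inner product.
   R^d is the subspace of the sequences supported on the coordinates {..<d}. *)

typedef finseq = "{x :: nat \<Rightarrow> real. finite {i. x i \<noteq> 0}}"
  morphisms coord Abs_finseq
  by (intro exI[of _ "\<lambda>_. 0"]) simp

setup_lifting type_definition_finseq

lemma finite_support: "finite {i. coord x i \<noteq> 0}"
  using coord[of x] by simp

lemma finseq_eqI: "(\<And>i. coord x i = coord y i) \<Longrightarrow> x = y"
  by (simp add: coord_inject[symmetric] ext)

instantiation finseq :: real_vector
begin

lift_definition zero_finseq :: finseq is "\<lambda>_. 0" by simp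

lift_definition plus_finseq :: "finseq \<Rightarrow> finseq \<Rightarrow> finseq" is "\<lambda>x y i. x i + y i"
  by (rule rev_finite_subset, erule (1) finite_UnI) auto

lift_definition minus_finseq :: "finseq \<Rightarrow> finseq \<Rightarrow> finseq" is "\<lambda>x y i. x i - y i"
  by (rule rev_finite_subset, erule (1) finite_UnI) auto

lift_definition uminus_finseq :: "finseq \<Rightarrow> finseq" is "\<lambda>x i. - x i" by simp

lift_definition scaleR_finseq :: "real \<Rightarrow> finseq \<Rightarrow> finseq" is "\<lambda>c x i. c * x i"
  by (erule finite_subset[rotated]) auto

instance
  by intro_classes (transfer; simp add: fun_eq_iff algebra_simps)+

end

lemmas coord_simps [simp] =
  zero_finseq.rep_eq plus_finseq.rep_eq minus_finseq.rep_eq uminus_finseq.rep_eq scaleR_finseq.rep_eq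

instantiation finseq :: real_inner
begin

definition inner_finseq :: "finseq \<Rightarrow> finseq \<Rightarrow> real"
  where "inner_finseq x y = (\<Sum>i | coord x i \<noteq> 0. coord x i * coord y i)"

definition norm_finseq :: "finseq \<Rightarrow> real"
  where "norm_finseq x = sqrt (inner x x)"

definition sgn_finseq :: "finseq \<Rightarrow> finseq"
  where "sgn_finseq x = x /\<^sub>R norm x"

definition dist_finseq :: "finseq \<Rightarrow> finseq \<Rightarrow> real"
  where "dist_finseq x y = norm (x - y)"

definition uniformity_finseq :: "(finseq \<times> finseq) filter"
  where "uniformity_finseq = (INF e\<in>{0<..}. principal {(x, y). dist (x::finseq) y < e})"

definition open_finseq :: "finseq set \<Rightarrow> bool"
  where "open_finseq U \<longleftrightarrow> (\<forall>x\<in>U. \<forall>\<^sub>F (x', y) in uniformity. x' = x \<longrightarrow> y \<in> U)"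

lemma inner_finseq_superset:
  assumes "finite A" "{i. coord x i \<noteq> 0} \<subseteq> A"
  shows "inner x y = (\<Sum>i\<in>A. coord x i * coord y i)"
  unfolding inner_finseq_def by (rule sum.mono_neutral_left) (use assms in auto)

instance
proof
  fix x y z :: finseq and r :: real
  define A where "A = {i. coord x i \<noteq> 0} \<union> {i. coord y i \<noteq> 0}"
  have A: "finite A" by (simp add: A_def finite_support)
  have x: "inner x v = (\<Sum>i\<in>A. coord x i * coord v i)"
    and y: "inner y v = (\<Sum>i\<in>A. coord y i * coord v i)"
    and xy: "inner (x + y) v = (\<Sum>i\<in>A. coord (x + y) i * coord v i)"
    and rx: "inner (r *\<^sub>R x) v = (\<Sum>i\<in>A. coord (r *\<^sub>R x) i * coord v i)" for v
    by (rule inner_finseq_superset[OF A]; force simp: A_def)+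
  show "inner x y = inner y x" by (simp add: x y mult.commute)
  show "inner (x + y) z = inner x z + inner y z"
    by (simp add: x y xy sum.distrib algebra_simps)
  show "inner (r *\<^sub>R x) y = r * inner x y"
    by (simp add: x rx sum_distrib_left algebra_simps)
  show "0 \<le> inner x x" by (simp add: x sum_nonneg)
  show "inner x x = 0 \<longleftrightarrow> x = 0"
  proof
    assume "inner x x = 0"
    then have "\<forall>i\<in>A. coord x i * coord x i = 0"
      using A by (simp add: x sum_nonneg_eq_0_iff)
    then have "coord x i = 0" if "i \<in> A" for i using that by simp
    moreover have "coord x i = 0" if "i \<notin> A" for i using that by (simp add: A_def)
    ultimately have "coord x i = coord 0 i" for i by (metis coord_simps(1))
    then show "x = 0" by (rule finseq_eqI)
  qed (simp add: inner_finseq_def)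
qed (fact norm_finseq_def sgn_finseq_def dist_finseq_def uniformity_finseq_def open_finseq_def)+

end

definition Rd :: "nat \<Rightarrow> finseq set"
  where "Rd d = {x. \<forall>i\<ge>d. coord x i = 0}"

lemma inner_Rd:
  assumes "x \<in> Rd d"
  shows "inner x y = (\<Sum>i<d. coord x i * coord y i)"
  by (rule inner_finseq_superset) (use assms in \<open>auto simp: Rd_def not_le[symmetric]\<close>)

lemma norm_Rd:
  assumes "x \<in> Rd d"
  shows "norm x = L2_set (coord x) {..<d}"
  by (simp add: norm_finseq_def inner_Rd[OF assms] L2_set_def power2_eq_square)

lemma subspace_Rd: "subspace (Rd d)"
  by (auto simp: subspace_def Rd_def)

lemma coord_Rd_surj: "\<exists>x\<in>Rd d. \<forall>i<d. coord x i = a i"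
  by (rule bexI[of _ "Abs_finseq (\<lambda>i. if i < d then a i else 0)"])
    (auto simp: Rd_def Abs_finseq_inverse)

(* Functions on R^d are HOL functions on finseq of which only the values on Rd d matter;
   hence the derivative within Rd d. *)
definition is_gradient :: "nat \<Rightarrow> (finseq \<Rightarrow> real) \<Rightarrow> finseq \<Rightarrow> finseq \<Rightarrow> bool"
  where "is_gradient d f w g \<longleftrightarrow>
    g \<in> Rd d \<and> (f has_derivative (\<lambda>h. inner g h)) (at w within Rd d)"

definition gradient :: "nat \<Rightarrow> (finseq \<Rightarrow> real) \<Rightarrow> finseq \<Rightarrow> finseq"
  where "gradient d f w = (THE g. is_gradient d f w g)"

lemma is_gradient_unique:
  assumes w: "w \<in> Rd d" and "is_gradient d f w g" "is_gradient d f w g'"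
  shows "g = g'"
proof -
  define h where "h = g - g'"
  have h: "h \<in> Rd d" using assms by (auto simp: h_def is_gradient_def Rd_def)
  have line: "((\<lambda>s. f (w + s *\<^sub>R h)) has_real_derivative inner v h) (at 0)"
    if "is_gradient d f w v" for v
  proof -
    have "((\<lambda>s. w + s *\<^sub>R h) has_derivative (\<lambda>s. s *\<^sub>R h)) (at (0::real))"
      by (auto intro!: derivative_eq_intros)
    moreover have "(f has_derivative inner v) (at (w + 0 *\<^sub>R h) within range (\<lambda>s. w + s *\<^sub>R h))"
      using that w h by (auto simp: is_gradient_def Rd_def intro: has_derivative_subset)
    ultimately have "((\<lambda>s. f (w + s *\<^sub>R h)) has_derivative (\<lambda>s. inner v (s *\<^sub>R h))) (at (0::real))"
      by (rule has_derivative_in_compose)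
    then show ?thesis by (simp add: has_field_derivative_def mult.commute[of _ "inner v h"] mult_commute_abs)
  qed
  have "inner g h = inner g' h"
    using DERIV_unique line assms(2,3) by blast
  then have "inner h h = 0" by (simp add: h_def inner_diff_left)
  then show ?thesis by (simp add: h_def)
qed

lemma gradient_eqI: "w \<in> Rd d \<Longrightarrow> is_gradient d f w g \<Longrightarrow> gradient d f w = g"
  unfolding gradient_def by (blast intro: is_gradient_unique)

definition continuously_differentiable :: "nat \<Rightarrow> (finseq \<Rightarrow> real) \<Rightarrow> bool"
  where "continuously_differentiable d f \<longleftrightarrow>
    (\<forall>w\<in>Rd d. \<exists>g. is_gradient d f w g) \<and> continuous_on (Rd d) (gradient d f)"

(* Weights are families indexed by S, represented by extensional functions. *)
definition capped_simplex :: "real \<Rightarrow> nat set \<Rightarrow> (nat \<Rightarrow> real) set"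
  where "capped_simplex \<theta> S =
    {\<pi> \<in> S \<rightarrow>\<^sub>E {0 .. 1 / (\<theta> * real (card S))}. (\<Sum>i\<in>S. \<pi> i) = 1}"

definition weighted_loss :: "(nat \<Rightarrow> finseq \<Rightarrow> real) \<Rightarrow> nat set \<Rightarrow> finseq \<Rightarrow> (nat \<Rightarrow> real) \<Rightarrow> real"
  where "weighted_loss F S w \<pi> = (\<Sum>i\<in>S. \<pi> i * F i w)"

(* A maximum: weighted_loss is linear in the weights, and for 0 < \<theta> < 1 and nonempty finite S
   the capped simplex is a nonempty compact polytope. *)
definition max_loss :: "real \<Rightarrow> (nat \<Rightarrow> finseq \<Rightarrow> real) \<Rightarrow> nat set \<Rightarrow> finseq \<Rightarrow> real"
  where "max_loss \<theta> F S w = (SUP \<pi>\<in>capped_simplex \<theta> S. weighted_loss F S w \<pi>)"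

definition client_sampling :: "nat \<Rightarrow> nat \<Rightarrow> nat set pmf"
  where "client_sampling n m = pmf_of_set {S. S \<subseteq> {1..n} \<and> card S = m}"

definition mean_max_loss :: "nat \<Rightarrow> nat \<Rightarrow> real \<Rightarrow> (nat \<Rightarrow> finseq \<Rightarrow> real) \<Rightarrow> finseq \<Rightarrow> real"
  where "mean_max_loss n m \<theta> F w =
    measure_pmf.expectation (client_sampling n m) (\<lambda>S. max_loss \<theta> F S w)"

definition moreau_envelope :: "nat \<Rightarrow> real \<Rightarrow> (finseq \<Rightarrow> real) \<Rightarrow> finseq \<Rightarrow> real"
  where "moreau_envelope d \<mu> f w = (INF z\<in>Rd d. f z + \<mu> / 2 * (norm (w - z))\<^sup>2)"

primrec local_iterate ::
    "real \<Rightarrow> real \<Rightarrow> (finseq \<Rightarrow> finseq) \<Rightarrow> finseq \<Rightarrow> nat \<Rightarrow> finseq" where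
  "local_iterate reg \<gamma> grad w 0 = w"
| "local_iterate reg \<gamma> grad w (Suc k) =
     (1 - \<gamma> * reg) *\<^sub>R local_iterate reg \<gamma> grad w k - \<gamma> *\<^sub>R grad (local_iterate reg \<gamma> grad w k)"

(* Ss is the list of the client samples of all rounds. The rule sel for choosing the weights sees
   the samples of the rounds 0..t, which together with the start determine the run up to then. *)
primrec iterate ::
    "nat \<Rightarrow> (nat \<Rightarrow> finseq \<Rightarrow> real) \<Rightarrow> real \<Rightarrow> real \<Rightarrow> nat \<Rightarrow> (nat set list \<Rightarrow> nat \<Rightarrow> real) \<Rightarrow>
     finseq \<Rightarrow> nat set list \<Rightarrow> nat \<Rightarrow> finseq" where
  "iterate d F reg \<gamma> \<tau> sel w0 Ss 0 = w0"
| "iterate d F reg \<gamma> \<tau> sel w0 Ss (Suc t) =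
     (\<Sum>i\<in>Ss ! t. sel (take (Suc t) Ss) i *\<^sub>R
        local_iterate reg \<gamma> (gradient d (F i)) (iterate d F reg \<gamma> \<tau> sel w0 Ss t) \<tau>)"

definition selects_maximizers ::
    "nat \<Rightarrow> nat \<Rightarrow> nat \<Rightarrow> real \<Rightarrow> (nat \<Rightarrow> finseq \<Rightarrow> real) \<Rightarrow> real \<Rightarrow> real \<Rightarrow> nat \<Rightarrow> nat \<Rightarrow>
     (nat set list \<Rightarrow> nat \<Rightarrow> real) \<Rightarrow> finseq \<Rightarrow> bool"
  where "selects_maximizers d n m \<theta> F reg \<gamma> \<tau> T sel w0 \<longleftrightarrow>
    (\<forall>Ss \<in> set_pmf (replicate_pmf T (client_sampling n m)). \<forall>t<T.
       is_arg_max (weighted_loss F (Ss ! t) (iterate d F reg \<gamma> \<tau> sel w0 Ss t))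
         (\<lambda>\<pi>. \<pi> \<in> capped_simplex \<theta> (Ss ! t)) (sel (take (Suc t) Ss)))"

definition output_pmf ::
    "nat \<Rightarrow> nat \<Rightarrow> nat \<Rightarrow> (nat \<Rightarrow> finseq \<Rightarrow> real) \<Rightarrow> real \<Rightarrow> real \<Rightarrow> nat \<Rightarrow> nat \<Rightarrow>
     (nat set list \<Rightarrow> nat \<Rightarrow> real) \<Rightarrow> finseq \<Rightarrow> finseq pmf"
  where "output_pmf d n m F reg \<gamma> \<tau> T sel w0 = do {
    Ss \<leftarrow> replicate_pmf T (client_sampling n m);
    t \<leftarrow> pmf_of_set {..<T};
    return_pmf (iterate d F reg \<gamma> \<tau> sel w0 Ss t)
  }"

(* For \<tau> = 1 the third term of the minimum is infinite, so it is dropped. *)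
definition learning_rate :: "nat \<Rightarrow> nat \<Rightarrow> real \<Rightarrow> real \<Rightarrow> real \<Rightarrow> real"
  where "learning_rate \<tau> T L G \<Delta> =
    (let a = 1 / (4 * real \<tau> * L);
         b = 1 / (real \<tau> * sqrt (real T)) * sqrt (\<Delta> / (L * G\<^sup>2));
         c = 1 / (real \<tau> * real T powr (1 / 3)) *
               (\<Delta> / (32 * L\<^sup>2 * G\<^sup>2 * (1 - 1 / real \<tau>))) powr (1 / 3)
     in if \<tau> = 1 then min a b else min a (min b c))"

end

theory Submission
  imports Defs
begin

text \<open>
  The mean loss \<open>f\<close> is \<open>L\<close>-weakly convex, so \<open>z \<mapsto> f z + L * (norm (w - z))\<^sup>2\<close> is \<open>L\<close>-strongly convex
  and has a minimizer \<open>z\<close> on the complete space \<open>Rd d\<close>; the envelope has the gradient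
  \<open>2 * L * (w - z)\<close> at \<open>w\<close>. A round moves \<open>w\<close> by \<open>- \<gamma> * \<tau>\<close> times a weak subgradient of the sampled
  maximal loss, up to a client drift of order \<open>\<gamma>\<^sup>2 * \<tau> * (\<tau> - 1) * L * G\<close>. Testing the envelope at the
  new point with the old \<open>z\<close> shows that it decreases in expectation by
  \<open>\<gamma> * \<tau> / 4\<close> times the squared norm of its gradient, up to the errors of the drift and of the
  step length. Telescoping over the rounds and inserting the step size gives the rate.
\<close>

section \<open>Weak convexity and the Moreau envelope\<close>

text \<open>The exact form of strong convexity of the squared distance. Its last term is what
  outweighs the weak convexity of the loss once the penalty is added.\<close>

lemma norm_sq_convex_combination:
  fixes x y w :: "'a::real_inner"
  shows "(norm ((1 - s) *\<^sub>R x + s *\<^sub>R y - w))\<^sup>2 =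
    (1 - s) * (norm (x - w))\<^sup>2 + s * (norm (y - w))\<^sup>2 - s * (1 - s) * (norm (x - y))\<^sup>2"
  by (simp add: power2_norm_eq_inner inner_add_left inner_add_right inner_diff_left inner_diff_right
      inner_commute) (simp add: inner_commute algebra_simps power2_eq_square)

text \<open>The midpoint of two nearly minimal points still has a value of at least the infimum, so
  strong midpoint convexity forces the two points to be close. Hence a minimizing sequence is
  Cauchy. Completeness is asked of \<open>V\<close> alone because \<open>finseq\<close> itself is
  not complete.\<close>

lemma strongly_midconvex_minimizer_exists:
  fixes h :: "'a::real_inner \<Rightarrow> real"
  assumes ne: "V \<noteq> {}" and compl: "uniform_space_class.complete V" and cont: "continuous_on V h"
    and mid: "\<And>x y. x \<in> V \<Longrightarrow> y \<in> V \<Longrightarrow> (1 / 2) *\<^sub>R (x + y) \<in> V"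
    and bdd: "bdd_below (h ` V)" and c: "c > 0"
    and strong: "\<And>x y. x \<in> V \<Longrightarrow> y \<in> V \<Longrightarrow>
      h ((1 / 2) *\<^sub>R (x + y)) \<le> (h x + h y) / 2 - c * (norm (x - y))\<^sup>2"
  obtains z where "z \<in> V" "\<And>y. y \<in> V \<Longrightarrow> h z \<le> h y"
proof -
  define I where "I = (INF x\<in>V. h x)"
  have lower: "I \<le> h x" if "x \<in> V" for x
    unfolding I_def using bdd that by (rule cINF_lower)
  define r where "r n = 1 / real (Suc n)" for n
  have "\<exists>x\<in>V. h x < I + r n" for n
    using cINF_less_iff[OF ne bdd, of "I + r n"] unfolding I_def by (simp add: r_def)
  then obtain X where X: "\<And>n. X n \<in> V" and hX: "\<And>n. h (X n) < I + r n"
    by metis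
  have "Cauchy X"
  proof (rule metric_CauchyI)
    fix e :: real
    assume e: "e > 0"
    then obtain N where N: "r N < c * e\<^sup>2"
      unfolding r_def using c nat_approx_posE[of "c * e\<^sup>2"] by (metis mult_pos_pos zero_less_power)
    have "dist (X i) (X j) < e" if ij: "i \<ge> N" "j \<ge> N" for i j
    proof -
      have "I \<le> (h (X i) + h (X j)) / 2 - c * (norm (X i - X j))\<^sup>2"
        using lower[OF mid[OF X X]] strong[OF X X] by (rule order_trans)
      moreover have "r i \<le> r N" "r j \<le> r N"
        using ij by (auto simp: r_def intro!: divide_left_mono)
      ultimately have "c * (norm (X i - X j))\<^sup>2 < r N"
        using hX[of i] hX[of j] by argo
      then have "c * (norm (X i - X j))\<^sup>2 < c * e\<^sup>2"
        using N by (rule less_trans)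
      then have "(norm (X i - X j))\<^sup>2 < e\<^sup>2" using c by simp
      then show ?thesis using e by (simp add: dist_norm power2_less_imp_less)
    qed
    then show "\<exists>M. \<forall>m\<ge>M. \<forall>n\<ge>M. dist (X m) (X n) < e" by blast
  qed
  with compl X have "\<exists>z\<in>V. X \<longlonglongrightarrow> z"
    by (simp add: metric_space_class.complete_def)
  then obtain z where z: "z \<in> V" "X \<longlonglongrightarrow> z" by blast
  have "(\<lambda>n. h (X n)) \<longlonglongrightarrow> h z"
    using continuous_on_tendsto_compose[OF cont z(2) z(1)] X by simp
  moreover have "(\<lambda>n. I + r n) \<longlonglongrightarrow> I + 0"
    unfolding r_def by (intro tendsto_add tendsto_const LIMSEQ_Suc[OF lim_const_over_n])
  ultimately have "h z \<le> I + 0"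
    by (rule LIMSEQ_le) (use hX less_imp_le in blast)
  with lower have "h z \<le> h y" if "y \<in> V" for y
    using that by force
  with z(1) show thesis by (rule that)
qed

text \<open>On a convex \<open>V\<close> this says that
  \<open>\<lambda>x. f x + L / 2 * (norm x)\<^sup>2\<close> is convex. Written as an inequality
  between values, it passes directly to averages and suprema of functions with the same
  \<open>L\<close>.\<close>

definition weakly_convex_on :: "real \<Rightarrow> 'a::real_inner set \<Rightarrow> ('a \<Rightarrow> real) \<Rightarrow> bool"
  where "weakly_convex_on L V f \<longleftrightarrow> (\<forall>x\<in>V. \<forall>y\<in>V. \<forall>s\<in>{0..1}.
    f ((1 - s) *\<^sub>R x + s *\<^sub>R y) \<le>
      (1 - s) * f x + s * f y + L / 2 * (s * (1 - s)) * (norm (x - y))\<^sup>2)"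

lemma weakly_convex_onD:
  assumes "weakly_convex_on L V f" "x \<in> V" "y \<in> V" "0 \<le> s" "s \<le> 1"
  shows "f ((1 - s) *\<^sub>R x + s *\<^sub>R y) \<le>
    (1 - s) * f x + s * f y + L / 2 * (s * (1 - s)) * (norm (x - y))\<^sup>2"
  using assms unfolding weakly_convex_on_def by auto

text \<open>The limit is built coordinatewise. Only the first \<open>d\<close> coordinates
  contribute to the norm, so convergence of each of them gives convergence in norm.\<close>

lemma complete_Rd: "uniform_space_class.complete (Rd d)"
  unfolding metric_space_class.complete_def
proof (intro allI impI, elim conjE)
  fix X assume X: "\<forall>n. X n \<in> Rd d" and cau: "Cauchy X"
  have coord_le: "\<bar>coord x i\<bar> \<le> norm x" if "x \<in> Rd d" "i < d" for x i
    unfolding norm_Rd[OF that(1)] L2_set_def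
    using that(2) by (intro real_le_rsqrt) (auto intro: member_le_sum)
  have diff: "X n - X m \<in> Rd d" for n m
    using X subspace_diff[OF subspace_Rd] by blast
  have "\<exists>l. (\<lambda>n. coord (X n) i) \<longlonglongrightarrow> l" if "i < d" for i
  proof -
    have "Cauchy (\<lambda>n. coord (X n) i)"
    proof (rule metric_CauchyI)
      fix e :: real assume "e > 0"
      then obtain M where M: "\<And>m n. m \<ge> M \<Longrightarrow> n \<ge> M \<Longrightarrow> dist (X m) (X n) < e"
        using metric_CauchyD[OF cau] by blast
      have "dist (coord (X m) i) (coord (X n) i) \<le> dist (X m) (X n)" for m n
        using coord_le[OF diff that, of m n] by (simp add: dist_norm)
      then show "\<exists>M. \<forall>m\<ge>M. \<forall>n\<ge>M. dist (coord (X m) i) (coord (X n) i) < e"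
        using M by (meson le_less_trans)
    qed
    then show ?thesis by (simp add: real_Cauchy_convergent flip: convergent_def)
  qed
  then obtain l where l: "\<And>i. i < d \<Longrightarrow> (\<lambda>n. coord (X n) i) \<longlonglongrightarrow> l i" by metis
  obtain z where z: "z \<in> Rd d" "\<And>i. i < d \<Longrightarrow> coord z i = l i"
    using coord_Rd_surj by blast
  have "(\<lambda>n. L2_set (coord (X n - z)) {..<d}) \<longlonglongrightarrow> L2_set (\<lambda>i. 0) {..<d}"
    unfolding L2_set_def
    by (intro tendsto_real_sqrt tendsto_sum tendsto_power)
      (use l z(2) in \<open>auto intro!: tendsto_eq_intros\<close>)
  moreover have "norm (X n - z) = L2_set (coord (X n - z)) {..<d}" for n
    using X z(1) by (intro norm_Rd subspace_diff[OF subspace_Rd]) auto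
  ultimately have "(\<lambda>n. norm (X n - z)) \<longlonglongrightarrow> 0"
    by (simp add: L2_set_def)
  then have "X \<longlonglongrightarrow> z"
    using LIM_zero_cancel tendsto_norm_zero_iff by blast
  with z(1) show "\<exists>l\<in>Rd d. X \<longlonglongrightarrow> l" by blast
qed

section \<open>Proximal points and the gradient of the envelope\<close>

locale moreau =
  fixes d :: nat and L \<mu> :: real and f :: "finseq \<Rightarrow> real"
  assumes weakly_convex: "weakly_convex_on L (Rd d) f"
    and nonneg: "\<And>x. x \<in> Rd d \<Longrightarrow> 0 \<le> f x"
    and continuous: "continuous_on (Rd d) f"
    and L_pos: "0 < L" and L_less: "L < \<mu>"
begin

abbreviation penalized :: "finseq \<Rightarrow> finseq \<Rightarrow> real"
  where "penalized w z \<equiv> f z + \<mu> / 2 * (norm (w - z))\<^sup>2"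

lemma penalized_nonneg: "z \<in> Rd d \<Longrightarrow> 0 \<le> penalized w z"
  using nonneg L_pos L_less by (intro add_nonneg_nonneg mult_nonneg_nonneg) auto

lemma penalized_bdd_below: "bdd_below (penalized w ` Rd d)"
  using penalized_nonneg by (intro bdd_belowI2[where m = 0]) auto

lemma envelope_le: "z \<in> Rd d \<Longrightarrow> moreau_envelope d \<mu> f w \<le> penalized w z"
  unfolding moreau_envelope_def by (rule cINF_lower[OF penalized_bdd_below])

lemma envelope_greatest:
  "(\<And>z. z \<in> Rd d \<Longrightarrow> b \<le> penalized w z) \<Longrightarrow> b \<le> moreau_envelope d \<mu> f w"
  unfolding moreau_envelope_def by (rule cINF_greatest) (use subspace_0[OF subspace_Rd] in auto)

text \<open>The penalty contributes the modulus \<open>\<mu>\<close> and weak convexity of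
  \<open>f\<close> costs \<open>L\<close>.\<close>

lemma penalized_strongly_convex:
  assumes "x \<in> Rd d" "y \<in> Rd d" "0 \<le> s" "s \<le> 1"
  shows "penalized w ((1 - s) *\<^sub>R x + s *\<^sub>R y) \<le>
    (1 - s) * penalized w x + s * penalized w y - (\<mu> - L) / 2 * (s * (1 - s)) * (norm (x - y))\<^sup>2"
proof -
  define p where "p = (1 - s) *\<^sub>R x + s *\<^sub>R y"
  have "\<mu> / 2 * (norm (w - p))\<^sup>2 = \<mu> / 2 * ((1 - s) * (norm (w - x))\<^sup>2 + s * (norm (w - y))\<^sup>2
      - s * (1 - s) * (norm (x - y))\<^sup>2)"
    by (simp add: p_def norm_minus_commute[of w] norm_sq_convex_combination)
  moreover have "f p \<le> (1 - s) * f x + s * f y + L / 2 * (s * (1 - s)) * (norm (x - y))\<^sup>2"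
    using weakly_convex_onD[OF weakly_convex assms] by (simp add: p_def)
  ultimately show ?thesis
    unfolding p_def[symmetric] by (simp add: field_simps)
qed

lemma prox_exists: "\<exists>z\<in>Rd d. \<forall>y\<in>Rd d. penalized w z \<le> penalized w y"
proof -
  have "\<exists>z. z \<in> Rd d \<and> (\<forall>y\<in>Rd d. penalized w z \<le> penalized w y)"
  \<comment> \<open>The constant is \<open>(\<mu> - L) / 2 * (s * (1 - s))\<close> at
    \<open>s = 1 / 2\<close>.\<close>
  proof (rule strongly_midconvex_minimizer_exists[of "Rd d" "penalized w" "(\<mu> - L) / 8"])
    show "continuous_on (Rd d) (penalized w)"
      by (intro continuous_intros continuous)
    fix x y assume "x \<in> Rd d" "y \<in> Rd d"
    then show "penalized w ((1 / 2) *\<^sub>R (x + y)) \<le>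
        (penalized w x + penalized w y) / 2 - (\<mu> - L) / 8 * (norm (x - y))\<^sup>2"
      using penalized_strongly_convex[of x y "1 / 2" w] by (simp add: scaleR_add_right field_simps)
  qed (use penalized_bdd_below complete_Rd L_less subspace_0[OF subspace_Rd] in
      \<open>auto intro!: subspace_scale subspace_add subspace_Rd\<close>)
  then show ?thesis by blast
qed

definition prox :: "finseq \<Rightarrow> finseq"
  where "prox w = (SOME z. z \<in> Rd d \<and> (\<forall>y\<in>Rd d. penalized w z \<le> penalized w y))"

lemma prox_in: "prox w \<in> Rd d" and prox_le: "y \<in> Rd d \<Longrightarrow> penalized w (prox w) \<le> penalized w y"
  using someI_ex[OF prox_exists[of w, unfolded Bex_def]] unfolding prox_def by blast+

lemma envelope_eq: "moreau_envelope d \<mu> f w = penalized w (prox w)"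
  using envelope_le[OF prox_in, of w w] envelope_greatest[OF prox_le, of w] by (rule antisym)

text \<open>Quadratic growth of a strongly convex function around its minimizer: compare the
  minimizer with the points of the segment towards \<open>y\<close>, divide by \<open>s\<close> and
  let \<open>s\<close> tend to 0.\<close>

lemma penalized_ge:
  assumes y: "y \<in> Rd d"
  shows "moreau_envelope d \<mu> f w + (\<mu> - L) / 2 * (norm (y - prox w))\<^sup>2 \<le> penalized w y"
proof -
  let ?k = "(\<mu> - L) / 2 * (norm (y - prox w))\<^sup>2"
  have "penalized w (prox w) + (1 - s) * ?k \<le> penalized w y" if s: "0 < s" "s \<le> 1" for s
  proof -
    have "(1 - s) *\<^sub>R prox w + s *\<^sub>R y \<in> Rd d"
      using y prox_in by (intro subspace_add subspace_scale subspace_Rd)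
    then have
      "penalized w (prox w) \<le> (1 - s) * penalized w (prox w) + s * penalized w y - s * (1 - s) * ?k"
      using penalized_strongly_convex[OF prox_in y, of s w w, OF less_imp_le] s prox_le[of "(1 - s) *\<^sub>R prox w + s *\<^sub>R y" w]
      unfolding norm_minus_commute[of y] by argo
    moreover have "(1 - s) * penalized w (prox w) = penalized w (prox w) - s * penalized w (prox w)"
      "s * (penalized w (prox w) + (1 - s) * ?k) = s * penalized w (prox w) + s * (1 - s) * ?k"
      by (simp_all only: left_diff_distrib distrib_left mult.assoc mult_1)
    ultimately have "s * (penalized w (prox w) + (1 - s) * ?k) \<le> s * penalized w y"
      by linarith
    then show ?thesis using s(1) mult_le_cancel_left_pos by blast
  qed
  then have "\<forall>\<^sub>F s in at_right 0. penalized w (prox w) + (1 - s) * ?k \<le> penalized w y"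
    unfolding eventually_at_right_field by (intro exI[of _ 1]) auto
  moreover have "((\<lambda>s. penalized w (prox w) + (1 - s) * ?k) \<longlongrightarrow>
      penalized w (prox w) + (1 - 0) * ?k) (at_right 0)"
    by (intro tendsto_intros)
  ultimately have "penalized w (prox w) + (1 - 0) * ?k \<le> penalized w y"
    by (intro tendsto_upperbound) auto
  then show ?thesis by (simp add: envelope_eq)
qed

text \<open>The envelope differs from its linearization by at most a multiple of
  \<open>(norm (v - w))\<^sup>2\<close>. The upper bound tests the envelope at \<open>v\<close> with
  the proximal point of \<open>w\<close>. For the lower bound, quadratic growth at \<open>w\<close>
  pays for moving from that point to any other competitor \<open>y\<close>.\<close>

lemma is_gradient_envelope:
  assumes w: "w \<in> Rd d"
  shows "is_gradient d (moreau_envelope d \<mu> f) w (\<mu> *\<^sub>R (w - prox w))"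
  unfolding is_gradient_def has_derivative_within_alt2
proof (intro conjI allI impI)
  let ?\<Phi> = "moreau_envelope d \<mu> f" and ?z = "prox w"
  \<comment> \<open>\<open>K\<close> is what Young's inequality leaves when the cross term
    \<open>\<mu> * (a * b)\<close> is absorbed by the growth term
    \<open>(\<mu> - L) / 2 * b\<^sup>2\<close>.\<close>
  define K where "K = \<mu>\<^sup>2 / (2 * (\<mu> - L))"
  show "\<mu> *\<^sub>R (w - ?z) \<in> Rd d"
    using w prox_in by (intro subspace_scale subspace_diff subspace_Rd)
  show "bounded_linear (\<lambda>h. inner (\<mu> *\<^sub>R (w - ?z)) h)"
    by (rule bounded_linear_inner_right)
  have expand: "\<mu> / 2 * (norm (v - y))\<^sup>2 = \<mu> / 2 * (norm (w - y))\<^sup>2 + \<mu> * inner (v - w) (w - y)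
      + \<mu> / 2 * (norm (v - w))\<^sup>2" for v y
    by (simp add: power2_norm_eq_inner inner_diff_left inner_diff_right inner_commute)
      (simp add: algebra_simps)
  have err: "\<bar>?\<Phi> v - ?\<Phi> w - inner (\<mu> *\<^sub>R (w - ?z)) (v - w)\<bar> \<le> (K + \<mu>) * (norm (v - w))\<^sup>2" for v
  proof -
    have K: "K \<ge> 0" using L_less by (simp add: K_def)
    have "?\<Phi> v \<le> penalized v ?z"
      by (rule envelope_le[OF prox_in])
    then have "?\<Phi> v \<le> ?\<Phi> w + \<mu> * inner (v - w) (w - ?z) + \<mu> / 2 * (norm (v - w))\<^sup>2"
      using expand[of v ?z] envelope_eq[of w] by linarith
    moreover have "?\<Phi> w + \<mu> * inner (v - w) (w - ?z) - K * (norm (v - w))\<^sup>2 \<le> ?\<Phi> v"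
    proof (rule envelope_greatest)
      fix y assume y: "y \<in> Rd d"
      have young: "\<mu> * (a * b) \<le> (\<mu> - L) / 2 * b\<^sup>2 + K * a\<^sup>2" for a b :: real
      proof -
        define k where "k = \<mu> - L"
        have k: "k > 0" using L_less by (simp add: k_def)
        then have "0 \<le> k / 2 * (b - \<mu> / k * a)\<^sup>2" by simp
        also have "\<dots> = k / 2 * b\<^sup>2 + \<mu>\<^sup>2 / (2 * k) * a\<^sup>2 - \<mu> * (a * b)"
          using k by (simp add: power2_eq_square field_simps)
        finally show ?thesis by (simp add: K_def k_def)
      qed
      have "inner (v - w) (y - ?z) \<le> norm (v - w) * norm (y - ?z)"
        by (rule norm_cauchy_schwarz)
      then have "\<mu> * inner (v - w) (y - ?z) \<le> \<mu> * (norm (v - w) * norm (y - ?z))"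
        using L_pos L_less by (intro mult_left_mono) auto
      with young[of "norm (v - w)" "norm (y - ?z)"] have
        "\<mu> * inner (v - w) (y - ?z) \<le> (\<mu> - L) / 2 * (norm (y - ?z))\<^sup>2 + K * (norm (v - w))\<^sup>2"
        by linarith
      moreover have "\<mu> * inner (v - w) (w - ?z) = \<mu> * inner (v - w) (w - y) + \<mu> * inner (v - w) (y - ?z)"
        by (simp add: inner_diff_right algebra_simps)
      moreover have "0 \<le> \<mu> / 2 * (norm (v - w))\<^sup>2"
        using L_pos L_less by simp
      ultimately show "?\<Phi> w + \<mu> * inner (v - w) (w - ?z) - K * (norm (v - w))\<^sup>2 \<le> penalized v y"
        using penalized_ge[OF y, of w] expand[of v y] by argo
    qed
    moreover have "0 \<le> \<mu> * (norm (v - w))\<^sup>2" "0 \<le> K * (norm (v - w))\<^sup>2"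
      using K L_pos L_less by auto
    ultimately show ?thesis
      by (simp add: inner_commute[of "v - w"] abs_le_iff distrib_right)
  qed
  fix e :: real assume e: "e > 0"
  have pos: "K + \<mu> > 0" using L_pos L_less by (simp add: K_def add_nonneg_pos)
  have "norm (?\<Phi> v - ?\<Phi> w - inner (\<mu> *\<^sub>R (w - ?z)) (v - w)) \<le> e * norm (v - w)"
    if "dist v w < e / (K + \<mu>)" for v
  proof -
    have "(K + \<mu>) * norm (v - w) \<le> e"
      using that pos by (simp add: dist_norm field_simps)
    then have "(K + \<mu>) * norm (v - w) * norm (v - w) \<le> e * norm (v - w)"
      by (rule mult_right_mono) simp
    with err[of v] show ?thesis by (simp add: power2_eq_square mult.assoc)
  qed
  moreover have "e / (K + \<mu>) > 0" using e pos by simp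
  ultimately show "\<forall>\<^sub>F v in at w within Rd d.
      norm (?\<Phi> v - ?\<Phi> w - inner (\<mu> *\<^sub>R (w - ?z)) (v - w)) \<le> e * norm (v - w)"
    unfolding eventually_at by blast
qed

lemma gradient_envelope:
  "w \<in> Rd d \<Longrightarrow> gradient d (moreau_envelope d \<mu> f) w = \<mu> *\<^sub>R (w - prox w)"
  by (intro gradient_eqI is_gradient_envelope)

end

section \<open>Smooth functions\<close>

lemma is_gradient_gradient:
  "continuously_differentiable d f \<Longrightarrow> w \<in> Rd d \<Longrightarrow> is_gradient d f w (gradient d f w)"
  unfolding continuously_differentiable_def by (metis gradient_eqI)

lemma gradient_in_Rd:
  "continuously_differentiable d f \<Longrightarrow> w \<in> Rd d \<Longrightarrow> gradient d f w \<in> Rd d"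
  using is_gradient_gradient unfolding is_gradient_def by blast

text \<open>Reduction to calculus in one variable: the whole line stays in \<open>Rd d\<close>, so
  the derivative within \<open>Rd d\<close> restricts to it.\<close>

lemma gradient_has_line_derivative:
  assumes f: "continuously_differentiable d f" and x: "x \<in> Rd d" and h: "h \<in> Rd d"
  shows "((\<lambda>s. f (x + s *\<^sub>R h)) has_real_derivative inner (gradient d f (x + s *\<^sub>R h)) h) (at s)"
proof -
  let ?g = "gradient d f (x + s *\<^sub>R h)"
  have line: "x + r *\<^sub>R h \<in> Rd d" for r
    using x h by (intro subspace_add subspace_scale subspace_Rd)
  have "((\<lambda>s. x + s *\<^sub>R h) has_derivative (\<lambda>s. s *\<^sub>R h)) (at s)"
    by (auto intro!: derivative_eq_intros)
  moreover have "(f has_derivative inner ?g) (at (x + s *\<^sub>R h) within range (\<lambda>s. x + s *\<^sub>R h))"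
    using is_gradient_gradient[OF f line] line
    by (auto simp: is_gradient_def intro: has_derivative_subset)
  ultimately have "((\<lambda>s. f (x + s *\<^sub>R h)) has_derivative (\<lambda>s. inner ?g (s *\<^sub>R h))) (at s)"
    by (rule has_derivative_in_compose)
  then show ?thesis
    by (simp add: has_field_derivative_def mult.commute[of _ "inner ?g h"] mult_commute_abs)
qed

text \<open>The difference quotient in the direction of the gradient \<open>g\<close> itself tends
  to \<open>inner g g\<close> but never exceeds \<open>G * norm g\<close>.\<close>

lemma norm_gradient_le_lipschitz:
  assumes f: "continuously_differentiable d f" and lip: "G-lipschitz_on (Rd d) f" and x: "x \<in> Rd d"
  shows "norm (gradient d f x) \<le> G"
proof -
  let ?g = "gradient d f x"
  have g: "?g \<in> Rd d" using f x by (rule gradient_in_Rd)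
  have "((\<lambda>s. f (x + s *\<^sub>R ?g)) has_real_derivative inner ?g ?g) (at 0)"
    using gradient_has_line_derivative[OF f x g, of 0] by simp
  then have "((\<lambda>s. (f (x + s *\<^sub>R ?g) - f x) / s) \<longlongrightarrow> inner ?g ?g) (at 0)"
    by (simp add: DERIV_def)
  moreover have "(f (x + s *\<^sub>R ?g) - f x) / s \<le> G * norm ?g" if "s \<noteq> 0" for s
  proof -
    have "x + s *\<^sub>R ?g \<in> Rd d"
      using x g by (intro subspace_add subspace_scale subspace_Rd)
    from lipschitz_onD[OF lip this x] have "\<bar>f (x + s *\<^sub>R ?g) - f x\<bar> \<le> G * norm ?g * \<bar>s\<bar>"
      by (simp add: dist_norm mult_ac)
    then have "\<bar>(f (x + s *\<^sub>R ?g) - f x) / s\<bar> \<le> G * norm ?g"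
      using that by (simp add: abs_divide divide_le_eq)
    then show ?thesis by linarith
  qed
  then have "\<forall>\<^sub>F s in at 0. (f (x + s *\<^sub>R ?g) - f x) / s \<le> G * norm ?g"
    by (auto simp: eventually_at_filter)
  ultimately have "inner ?g ?g \<le> G * norm ?g"
    by (rule tendsto_upperbound) simp
  then have "norm ?g * norm ?g \<le> G * norm ?g"
    by (simp add: power2_norm_eq_inner[symmetric] power2_eq_square)
  then show ?thesis
    using lipschitz_on_nonneg[OF lip] by (cases "norm ?g = 0") auto
qed

lemma smooth_quadratic_lower_bound:
  assumes f: "continuously_differentiable d f" and lip: "L-lipschitz_on (Rd d) (gradient d f)"
    and x: "x \<in> Rd d" and y: "y \<in> Rd d"
  shows "f x + inner (gradient d f x) (y - x) - L / 2 * (norm (y - x))\<^sup>2 \<le> f y"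
proof -
  define h where "h = y - x"
  have h: "h \<in> Rd d" using x y by (simp add: h_def subspace_diff[OF subspace_Rd])
  \<comment> \<open>The gap between \<open>f\<close> and the claimed quadratic bound along the
    segment, up to the constant \<open>f x\<close>. The Lipschitz gradient makes its derivative
    nonnegative on the unit interval, and comparing the endpoints is the claim.\<close>
  define \<psi> where "\<psi> s = f (x + s *\<^sub>R h) - s * inner (gradient d f x) h + L / 2 * s\<^sup>2 * (norm h)\<^sup>2" for s
  have "\<exists>D. (\<psi> has_real_derivative D) (at s) \<and> 0 \<le> D" if s: "0 \<le> s" "s \<le> 1" for s
  proof (intro exI conjI)
    let ?g = "gradient d f (x + s *\<^sub>R h)"
    show "(\<psi> has_real_derivative inner ?g h - inner (gradient d f x) h + L * s * (norm h)\<^sup>2) (at s)"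
      unfolding \<psi>_def
      by (auto intro!: derivative_eq_intros gradient_has_line_derivative[OF f x h])
    have "x + s *\<^sub>R h \<in> Rd d"
      using x h by (intro subspace_add subspace_scale subspace_Rd)
    from lipschitz_onD[OF lip this x] have "norm (?g - gradient d f x) \<le> L * (s * norm h)"
      using s by (simp add: dist_norm)
    then have "norm (?g - gradient d f x) * norm h \<le> L * (s * norm h) * norm h"
      by (rule mult_right_mono) simp
    moreover have "\<bar>inner (?g - gradient d f x) h\<bar> \<le> norm (?g - gradient d f x) * norm h"
      by (rule Cauchy_Schwarz_ineq2)
    ultimately show "0 \<le> inner ?g h - inner (gradient d f x) h + L * s * (norm h)\<^sup>2"
      by (simp add: inner_diff_left power2_eq_square mult_ac)
  qed
  then have "\<psi> 0 \<le> \<psi> 1" by (rule DERIV_nonneg_imp_nondecreasing[OF zero_le_one])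
  then show ?thesis by (simp add: \<psi>_def h_def)
qed

text \<open>Both endpoints are bounded below from the intermediate point \<open>p\<close>. Since
  \<open>x - p\<close> and \<open>y - p\<close> are opposite multiples of \<open>y - x\<close>,
  averaging with the weights \<open>1 - s\<close> and \<open>s\<close> cancels the linear
  terms.\<close>

lemma weakly_convex_on_if_quadratic_lower_bound:
  assumes V: "subspace V"
    and lower: "\<And>x y. x \<in> V \<Longrightarrow> y \<in> V \<Longrightarrow>
      f x + inner (g x) (y - x) - L / 2 * (norm (y - x))\<^sup>2 \<le> f y"
  shows "weakly_convex_on L V f"
  unfolding weakly_convex_on_def
proof (intro ballI)
  fix x y s assume xy: "x \<in> V" "y \<in> V" and s: "s \<in> {0..1::real}"
  define p where "p = (1 - s) *\<^sub>R x + s *\<^sub>R y"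
  have p: "p \<in> V" using V xy by (simp add: p_def subspace_add subspace_scale)
  have px: "x - p = (- s) *\<^sub>R (y - x)" and py: "y - p = (1 - s) *\<^sub>R (y - x)"
    by (simp_all add: p_def algebra_simps)
  let ?D = "(norm (y - x))\<^sup>2" and ?I = "inner (g p) (y - x)"
  have "f p - s * ?I - L / 2 * (s\<^sup>2 * ?D) \<le> f x"
    using lower[OF p xy(1)] by (simp only: px inner_scaleR_right norm_scaleR power_mult_distrib power2_abs) simp
  from mult_left_mono[OF this, of "1 - s"] s
  have 1: "(1 - s) * (f p - s * ?I - L / 2 * (s\<^sup>2 * ?D)) \<le> (1 - s) * f x" by simp
  have "f p + (1 - s) * ?I - L / 2 * ((1 - s)\<^sup>2 * ?D) \<le> f y"
    using lower[OF p xy(2)] by (simp only: py inner_scaleR_right norm_scaleR power_mult_distrib power2_abs)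
  from mult_left_mono[OF this, of s] s
  have 2: "s * (f p + (1 - s) * ?I - L / 2 * ((1 - s)\<^sup>2 * ?D)) \<le> s * f y" by simp
  \<comment> \<open>The quadratic coefficients combine by
    \<open>(1 - s) * s\<^sup>2 + s * (1 - s)\<^sup>2 = s * (1 - s)\<close>.\<close>
  have "(1 - s) * (f p - s * ?I - L / 2 * (s\<^sup>2 * ?D)) +
      s * (f p + (1 - s) * ?I - L / 2 * ((1 - s)\<^sup>2 * ?D)) = f p - L / 2 * (s * (1 - s)) * ?D"
    by (simp add: power2_eq_square field_simps)
  with 1 2 show "f ((1 - s) *\<^sub>R x + s *\<^sub>R y) \<le>
      (1 - s) * f x + s * f y + L / 2 * (s * (1 - s)) * (norm (x - y))\<^sup>2"
    unfolding p_def[symmetric] norm_minus_commute[of x] by linarith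
qed

section \<open>Finitely supported distributions\<close>

text \<open>The tower rule; finite supports supply the integrability, so \<open>h\<close> may be any
  real function.\<close>

lemma integral_bind_pmf_finite:
  fixes p :: "'a pmf" and f :: "'a \<Rightarrow> 'b pmf" and h :: "'b \<Rightarrow> real"
  assumes p: "finite (set_pmf p)" and f: "\<And>x. x \<in> set_pmf p \<Longrightarrow> finite (set_pmf (f x))"
  shows "measure_pmf.expectation (p \<bind> f) h =
    measure_pmf.expectation p (\<lambda>x. measure_pmf.expectation (f x) h)"
proof -
  have "measure_pmf.expectation p g = (\<Sum>x\<in>set_pmf p. pmf p x *\<^sub>R g x)" for g :: "'a \<Rightarrow> real"
    by (rule integral_measure_pmf[OF p]) auto
  then show ?thesis
    using pmf_expectation_bind[OF p _ order_refl, of f h] f by simp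
qed

lemma integral_pmf_mono:
  fixes f g :: "'a \<Rightarrow> real"
  assumes "finite (set_pmf p)" "\<And>x. x \<in> set_pmf p \<Longrightarrow> f x \<le> g x"
  shows "measure_pmf.expectation p f \<le> measure_pmf.expectation p g"
  using assms by (intro integral_mono_AE integrable_measure_pmf_finite) (auto simp: AE_measure_pmf_iff)

text \<open>Splits off the last sample instead of the first, which allows conditioning on all
  earlier rounds.\<close>

lemma replicate_pmf_snoc:
  "replicate_pmf (Suc t) p = replicate_pmf t p \<bind> (\<lambda>xs. map_pmf (\<lambda>x. xs @ [x]) p)"
  using replicate_pmf_distrib[of t 1 p]
  by (simp add: map_pmf_def bind_return_pmf bind_assoc_pmf)

text \<open>The marginal law of the first \<open>t\<close> rounds: the remaining independent samples
  integrate out.\<close>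

lemma map_take_replicate_pmf:
  assumes "t \<le> T"
  shows "map_pmf (take t) (replicate_pmf T p) = replicate_pmf t p"
proof -
  have "map_pmf (take t) (replicate_pmf (t + (T - t)) p) =
      replicate_pmf t p \<bind> (\<lambda>xs. replicate_pmf (T - t) p \<bind> (\<lambda>ys. return_pmf (take t (xs @ ys))))"
    by (simp only: replicate_pmf_distrib map_bind_pmf map_return_pmf)
  also have "\<dots> = replicate_pmf t p \<bind> (\<lambda>xs. replicate_pmf (T - t) p \<bind> (\<lambda>ys. return_pmf xs))"
    by (intro bind_pmf_cong refl) (simp add: set_replicate_pmf)
  also have "\<dots> = replicate_pmf t p"
    by (simp add: bind_return_pmf')
  finally show ?thesis using assms by simp
qed

lemma finite_set_replicate_pmf:
  "finite (set_pmf p) \<Longrightarrow> finite (set_pmf (replicate_pmf n p))"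
  by (induction n) auto

text \<open>Causality of the run: round \<open>t\<close> reads \<open>Ss ! t\<close>, and
  \<open>sel\<close> sees only \<open>take (Suc t) Ss\<close>, so later samples have no
  influence.\<close>

lemma iterate_append:
  "t \<le> length Ss \<Longrightarrow>
    iterate d F reg \<gamma> \<tau> sel w0 (Ss @ Ss') t = iterate d F reg \<gamma> \<tau> sel w0 Ss t"
  by (induction t) (auto simp: nth_append)

section \<open>The maximal losses and one round of the algorithm\<close>

locale smooth_losses =
  fixes d n m :: nat and \<theta> B G L :: real and F :: "nat \<Rightarrow> finseq \<Rightarrow> real"
  assumes m: "1 \<le> m" "m \<le> n" and \<theta>: "0 < \<theta>" "\<theta> < 1" and L_pos: "0 < L"
    and nonneg: "\<And>i w. i \<in> {1..n} \<Longrightarrow> w \<in> Rd d \<Longrightarrow> 0 \<le> F i w"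
    and upper: "\<And>i w. i \<in> {1..n} \<Longrightarrow> w \<in> Rd d \<Longrightarrow> F i w \<le> B"
    and lipschitz: "\<And>i. i \<in> {1..n} \<Longrightarrow> G-lipschitz_on (Rd d) (F i)"
    and smooth: "\<And>i. i \<in> {1..n} \<Longrightarrow> continuously_differentiable d (F i)"
    and lipschitz_gradient: "\<And>i. i \<in> {1..n} \<Longrightarrow> L-lipschitz_on (Rd d) (gradient d (F i))"
begin

lemma G_nonneg: "0 \<le> G"
  using lipschitz_on_nonneg[OF lipschitz[of 1]] m by simp

lemma set_client_sampling: "set_pmf (client_sampling n m) = {S. S \<subseteq> {1..n} \<and> card S = m}"
  unfolding client_sampling_def
proof (rule set_pmf_of_set)
  show "{S. S \<subseteq> {1..n} \<and> card S = m} \<noteq> {}"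
    using m obtain_subset_with_card_n[of m "{1..n}"] by auto
qed simp

lemma finite_clients: "finite (set_pmf (client_sampling n m))"
  by (simp add: set_client_sampling)

lemma clientsD:
  assumes "S \<in> set_pmf (client_sampling n m)"
  shows "S \<subseteq> {1..n}" "card S = m" "finite S" "S \<noteq> {}"
  using assms m finite_subset[of S "{1..n}"] by (auto simp: set_client_sampling)

lemma capped_simplexD:
  assumes "\<pi> \<in> capped_simplex \<theta> S"
  shows "i \<in> S \<Longrightarrow> 0 \<le> \<pi> i" "(\<Sum>i\<in>S. \<pi> i) = 1"
  using assms by (auto simp: capped_simplex_def)

lemma capped_simplex_ne:
  assumes "S \<in> set_pmf (client_sampling n m)"
  shows "capped_simplex \<theta> S \<noteq> {}"
proof -
  \<comment> \<open>Uniform weights respect the cap \<open>1 / (\<theta> * m)\<close> because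
    \<open>\<theta> < 1\<close>.\<close>
  have "(\<lambda>i\<in>S. 1 / real m) \<in> capped_simplex \<theta> S"
    using clientsD[OF assms] m \<theta> by (auto simp: capped_simplex_def field_simps)
  then show ?thesis by blast
qed

lemma weighted_mean_le:
  assumes "\<pi> \<in> capped_simplex \<theta> S" "\<And>i. i \<in> S \<Longrightarrow> a i \<le> (b::real)"
  shows "(\<Sum>i\<in>S. \<pi> i * a i) \<le> b"
proof -
  have "(\<Sum>i\<in>S. \<pi> i * a i) \<le> (\<Sum>i\<in>S. \<pi> i * b)"
    using assms capped_simplexD(1)[OF assms(1)] by (intro sum_mono mult_left_mono) auto
  then show ?thesis
    using capped_simplexD(2)[OF assms(1)] by (simp flip: sum_distrib_right)
qed

lemma weighted_loss_mono:
  assumes "\<pi> \<in> capped_simplex \<theta> S" "\<And>i. i \<in> S \<Longrightarrow> F i x \<le> F i y + (c::real)"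
  shows "weighted_loss F S x \<pi> \<le> weighted_loss F S y \<pi> + c"
  using weighted_mean_le[OF assms(1), of "\<lambda>i. F i x - F i y" c] assms(2)
  by (simp add: weighted_loss_def right_diff_distrib sum_subtractf algebra_simps)

section \<open>The maximal loss of a fixed client sample\<close>

context
  fixes S assumes S: "S \<in> set_pmf (client_sampling n m)"
begin

text \<open>The upper bound \<open>B\<close> on the losses bounds the set of weighted losses from
  above, so that the real-valued \<open>SUP\<close> is a genuine upper bound.\<close>

lemma weighted_loss_le_max_loss:
  assumes "\<pi> \<in> capped_simplex \<theta> S" "w \<in> Rd d"
  shows "weighted_loss F S w \<pi> \<le> max_loss \<theta> F S w"
  unfolding max_loss_def
proof (rule cSUP_upper[OF assms(1)])
  have "weighted_loss F S w \<pi>' \<le> B" if "\<pi>' \<in> capped_simplex \<theta> S" for \<pi>'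
    unfolding weighted_loss_def using that upper[OF _ assms(2)] clientsD(1)[OF S]
    by (intro weighted_mean_le) auto
  then show "bdd_above (weighted_loss F S w ` capped_simplex \<theta> S)"
    by (intro bdd_aboveI2)
qed

lemma max_loss_le:
  "(\<And>\<pi>. \<pi> \<in> capped_simplex \<theta> S \<Longrightarrow> weighted_loss F S w \<pi> \<le> b) \<Longrightarrow> max_loss \<theta> F S w \<le> b"
  unfolding max_loss_def by (rule cSUP_least[OF capped_simplex_ne[OF S]])

lemma max_loss_nonneg:
  assumes w: "w \<in> Rd d"
  shows "0 \<le> max_loss \<theta> F S w"
proof -
  obtain \<pi> where \<pi>: "\<pi> \<in> capped_simplex \<theta> S" using capped_simplex_ne[OF S] by blast
  have "0 \<le> weighted_loss F S w \<pi>"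
    unfolding weighted_loss_def using nonneg[OF _ w] capped_simplexD(1)[OF \<pi>] clientsD(1)[OF S]
    by (intro sum_nonneg mult_nonneg_nonneg) auto
  then show ?thesis using weighted_loss_le_max_loss[OF \<pi> w] by linarith
qed

lemma max_loss_lipschitz:
  assumes x: "x \<in> Rd d" and y: "y \<in> Rd d"
  shows "max_loss \<theta> F S x \<le> max_loss \<theta> F S y + G * norm (x - y)"
proof (rule max_loss_le)
  fix \<pi> assume \<pi>: "\<pi> \<in> capped_simplex \<theta> S"
  have "F i x \<le> F i y + G * norm (x - y)" if "i \<in> S" for i
    using lipschitz_onD[OF lipschitz x y, of i] that clientsD(1)[OF S]
    by (auto simp: dist_norm abs_le_iff)
  from weighted_loss_mono[OF \<pi> this] weighted_loss_le_max_loss[OF \<pi> y]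
  show "weighted_loss F S x \<pi> \<le> max_loss \<theta> F S y + G * norm (x - y)" by force
qed

text \<open>Smoothness makes each client loss weakly convex with constant \<open>L\<close>.
  Averaging with fixed weights keeps the constant, and so does the supremum over the
  weights.\<close>

lemma max_loss_weakly_convex: "weakly_convex_on L (Rd d) (max_loss \<theta> F S)"
  unfolding weakly_convex_on_def
proof (intro ballI max_loss_le)
  fix x y s \<pi>
  assume x: "x \<in> Rd d" and y: "y \<in> Rd d" and s: "s \<in> {0..1::real}" and \<pi>: "\<pi> \<in> capped_simplex \<theta> S"
  let ?p = "(1 - s) *\<^sub>R x + s *\<^sub>R y" and ?c = "L / 2 * (s * (1 - s)) * (norm (x - y))\<^sup>2"
  have "F i ?p - ((1 - s) * F i x + s * F i y) \<le> ?c" if "i \<in> S" for i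
  proof -
    have i: "i \<in> {1..n}" using that clientsD(1)[OF S] by blast
    have "weakly_convex_on L (Rd d) (F i)"
      using smooth_quadratic_lower_bound[OF smooth[OF i] lipschitz_gradient[OF i]]
      by (rule weakly_convex_on_if_quadratic_lower_bound[OF subspace_Rd])
    then show ?thesis using weakly_convex_onD[OF _ x y] s by fastforce
  qed
  then have "(\<Sum>i\<in>S. \<pi> i * (F i ?p - ((1 - s) * F i x + s * F i y))) \<le> ?c"
    by (rule weighted_mean_le[OF \<pi>])
  moreover have "(\<Sum>i\<in>S. \<pi> i * (F i ?p - ((1 - s) * F i x + s * F i y))) =
      (\<Sum>i\<in>S. \<pi> i * F i ?p - ((1 - s) * (\<pi> i * F i x) + s * (\<pi> i * F i y)))"
    by (intro sum.cong refl) (simp add: algebra_simps)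
  ultimately have "weighted_loss F S ?p \<pi> \<le>
      (1 - s) * weighted_loss F S x \<pi> + s * weighted_loss F S y \<pi> + ?c"
    unfolding weighted_loss_def by (simp only: sum_subtractf sum.distrib sum_distrib_left)
  also have "\<dots> \<le> (1 - s) * max_loss \<theta> F S x + s * max_loss \<theta> F S y + ?c"
    using s weighted_loss_le_max_loss[OF \<pi>] x y
    by (intro add_right_mono, intro add_mono mult_left_mono) auto
  finally show "weighted_loss F S ?p \<pi> \<le> \<dots>" .
qed

end

section \<open>The mean loss and its envelope\<close>

abbreviation mean_loss :: "finseq \<Rightarrow> real"
  where "mean_loss \<equiv> mean_max_loss n m \<theta> F"

lemmas integrable_clients [simp] = integrable_measure_pmf_finite[OF finite_clients]
lemmas expectation_clients_mono = integral_pmf_mono[OF finite_clients]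

lemma mean_loss_nonneg: "w \<in> Rd d \<Longrightarrow> 0 \<le> mean_loss w"
  unfolding mean_max_loss_def
  using expectation_clients_mono[of "\<lambda>_. 0"] max_loss_nonneg by fastforce

lemma mean_loss_lipschitz: "G-lipschitz_on (Rd d) mean_loss"
proof (rule lipschitz_onI[OF _ G_nonneg])
  have le: "mean_loss x \<le> mean_loss y + G * norm (x - y)" if "x \<in> Rd d" "y \<in> Rd d" for x y
    unfolding mean_max_loss_def
    using expectation_clients_mono[OF max_loss_lipschitz[OF _ that]] by simp
  fix x y assume "x \<in> Rd d" "y \<in> Rd d"
  then show "dist (mean_loss x) (mean_loss y) \<le> G * dist x y"
    using le[of x y] le[of y x] by (simp add: dist_norm norm_minus_commute abs_le_iff)
qed

lemma mean_loss_weakly_convex: "weakly_convex_on L (Rd d) mean_loss"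
  unfolding weakly_convex_on_def
proof (intro ballI)
  fix x y s assume xy: "x \<in> Rd d" "y \<in> Rd d" and s: "s \<in> {0..1::real}"
  show "mean_loss ((1 - s) *\<^sub>R x + s *\<^sub>R y) \<le>
      (1 - s) * mean_loss x + s * mean_loss y + L / 2 * (s * (1 - s)) * (norm (x - y))\<^sup>2"
    unfolding mean_max_loss_def
    using expectation_clients_mono[OF weakly_convex_onD[OF max_loss_weakly_convex xy, of _ s]] s by simp
qed

text \<open>With the penalty parameter \<open>2 * L\<close>, the penalized mean loss is strongly
  convex with modulus \<open>2 * L - L = L\<close>.\<close>

sublocale moreau d L "2 * L" mean_loss
  by unfold_locales
    (use mean_loss_weakly_convex mean_loss_nonneg L_pos lipschitz_on_continuous_on[OF mean_loss_lipschitz]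
      in auto)

abbreviation envelope :: "finseq \<Rightarrow> real"
  where "envelope \<equiv> moreau_envelope d (2 * L) mean_loss"

abbreviation gradient_sq :: "finseq \<Rightarrow> real"
  where "gradient_sq w \<equiv> (norm (gradient d envelope w))\<^sup>2"

lemma gradient_sq_eq: "w \<in> Rd d \<Longrightarrow> gradient_sq w = 4 * L\<^sup>2 * (norm (w - prox w))\<^sup>2"
  by (simp add: gradient_envelope power_mult_distrib)

lemma envelope_bdd_below: "bdd_below (envelope ` Rd d)"
  by (intro bdd_belowI2[where m = 0] envelope_greatest penalized_nonneg)

text \<open>Moving from \<open>w\<close> to its proximal point lowers the envelope by at least
  \<open>L * (norm (w - prox w))\<^sup>2\<close>. In particular the gradient vanishes at minimizers
  of the envelope, which settles the case of a vanishing gap.\<close>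

lemma gradient_sq_le:
  assumes w: "w \<in> Rd d"
  shows "gradient_sq w \<le> 4 * L * (envelope w - (INF v\<in>Rd d. envelope v))"
proof -
  have "(INF v\<in>Rd d. envelope v) \<le> envelope (prox w)"
    using envelope_bdd_below prox_in by (rule cINF_lower)
  also have "envelope (prox w) \<le> mean_loss (prox w)"
    using envelope_le[OF prox_in, of "prox w" w] by simp
  also have "\<dots> = envelope w - L * (norm (w - prox w))\<^sup>2"
    by (simp add: envelope_eq)
  finally have "L * (norm (w - prox w))\<^sup>2 \<le> envelope w - (INF v\<in>Rd d. envelope v)" by linarith
  then have "4 * L * (L * (norm (w - prox w))\<^sup>2) \<le> 4 * L * (envelope w - (INF v\<in>Rd d. envelope v))"
    using L_pos by (intro mult_left_mono) auto
  then show ?thesis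
    unfolding gradient_sq_eq[OF w] by (simp add: power2_eq_square mult.assoc)
qed

text \<open>The envelope lies below the mean loss pointwise, and a nonnegative penalty cannot push
  it below the infimum of the mean loss.\<close>

lemma envelope_gap_le:
  assumes w: "w \<in> Rd d"
  shows "envelope w - (INF v\<in>Rd d. envelope v) \<le> mean_loss w - (INF v\<in>Rd d. mean_loss v)"
proof -
  have "(INF v\<in>Rd d. mean_loss v) \<le> (INF v\<in>Rd d. envelope v)"
  proof (rule cINF_greatest)
    show "Rd d \<noteq> {}" using w by blast
    fix v
    show "(INF v\<in>Rd d. mean_loss v) \<le> envelope v"
    proof (rule envelope_greatest)
      fix z assume z: "z \<in> Rd d"
      have "(INF v\<in>Rd d. mean_loss v) \<le> mean_loss z"
        using mean_loss_nonneg z by (intro cINF_lower bdd_belowI2[where m = 0])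
      then show "(INF v\<in>Rd d. mean_loss v) \<le> penalized v z"
        using L_pos by (simp add: add_increasing2)
    qed
  qed
  moreover have "envelope w \<le> mean_loss w"
    using envelope_le[OF w, of w] by simp
  ultimately show ?thesis by linarith
qed

section \<open>The local steps of one client\<close>

context
  fixes i assumes i: "i \<in> {1..n}"
begin

abbreviation local_step :: "real \<Rightarrow> finseq \<Rightarrow> nat \<Rightarrow> finseq"
  where "local_step \<gamma> \<equiv> local_iterate 0 \<gamma> (gradient d (F i))"

lemma local_step_in_Rd: "w \<in> Rd d \<Longrightarrow> local_step \<gamma> w k \<in> Rd d"
  by (induction k)
    (simp_all add: gradient_in_Rd[OF smooth[OF i]] subspace_diff subspace_scale subspace_Rd)

lemma local_step_dist:
  assumes w: "w \<in> Rd d" and \<gamma>: "0 \<le> \<gamma>"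
  shows "norm (local_step \<gamma> w k - w) \<le> \<gamma> * real k * G"
proof (induction k)
  case (Suc k)
  let ?v = "local_step \<gamma> w k"
  have "norm (local_step \<gamma> w (Suc k) - w) = norm ((?v - w) - \<gamma> *\<^sub>R gradient d (F i) ?v)"
    by (simp add: algebra_simps)
  also have "\<dots> \<le> norm (?v - w) + \<gamma> * norm (gradient d (F i) ?v)"
    using norm_triangle_ineq4[of "?v - w" "\<gamma> *\<^sub>R gradient d (F i) ?v"] \<gamma> by simp
  also have "\<dots> \<le> \<gamma> * real k * G + \<gamma> * G"
    using Suc norm_gradient_le_lipschitz[OF smooth[OF i] lipschitz[OF i] local_step_in_Rd[OF w]] \<gamma>
    by (intro add_mono mult_left_mono) auto
  finally show ?case by (simp add: algebra_simps)
qed simp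

text \<open>Compares \<open>k\<close> local steps with \<open>k\<close> gradient steps that all use
  the gradient at \<open>w\<close>. After \<open>j\<close> steps the point has moved by at most
  \<open>\<gamma> * j * G\<close>, so the next step adds an error of at most
  \<open>\<gamma> * L * (\<gamma> * j * G)\<close>; summing over \<open>j < k\<close> gives the
  factor \<open>k * (k - 1) / 2\<close>, which vanishes for a single step.\<close>

lemma local_step_drift:
  assumes w: "w \<in> Rd d" and \<gamma>: "0 \<le> \<gamma>"
  shows "norm (local_step \<gamma> w k - (w - (\<gamma> * real k) *\<^sub>R gradient d (F i) w)) \<le>
    \<gamma>\<^sup>2 * L * G * (real k * (real k - 1) / 2)"
proof (induction k)
  case (Suc k)
  let ?v = "local_step \<gamma> w k" and ?g = "gradient d (F i)"
  let ?e = "?v - (w - (\<gamma> * real k) *\<^sub>R ?g w)"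
  have "norm (local_step \<gamma> w (Suc k) - (w - (\<gamma> * real (Suc k)) *\<^sub>R ?g w)) =
      norm (?e - \<gamma> *\<^sub>R (?g ?v - ?g w))"
    by (simp add: algebra_simps)
  also have "\<dots> \<le> norm ?e + \<gamma> * norm (?g ?v - ?g w)"
    using norm_triangle_ineq4[of ?e "\<gamma> *\<^sub>R (?g ?v - ?g w)"] \<gamma> by simp
  also have "\<dots> \<le> \<gamma>\<^sup>2 * L * G * (real k * (real k - 1) / 2) + \<gamma> * (L * (\<gamma> * real k * G))"
  proof (intro add_mono mult_left_mono)
    have "norm (?g ?v - ?g w) \<le> L * norm (?v - w)"
      using lipschitz_onD[OF lipschitz_gradient[OF i] local_step_in_Rd[OF w] w]
      by (simp add: dist_norm)
    also have "\<dots> \<le> L * (\<gamma> * real k * G)"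
      using L_pos local_step_dist[OF w \<gamma>] by (intro mult_left_mono) auto
    finally show "norm (?g ?v - ?g w) \<le> L * (\<gamma> * real k * G)" .
  qed (use Suc \<gamma> in auto)
  also have "\<dots> = \<gamma>\<^sup>2 * L * G * (real (Suc k) * (real (Suc k) - 1) / 2)"
    by (simp add: power2_eq_square field_simps)
  finally show ?case .
qed simp

text \<open>Up to the drift, the displacement is \<open>- \<gamma> * k\<close> times the gradient at
  \<open>w\<close>. The quadratic lower bound turns its inner product with \<open>w - z\<close> into
  a difference of losses, and Cauchy-Schwarz bounds the drift.\<close>

lemma inner_local_step_le:
  assumes w: "w \<in> Rd d" and z: "z \<in> Rd d" and \<gamma>: "0 \<le> \<gamma>"
  shows "inner (local_step \<gamma> w k - w) (w - z) \<le>
    \<gamma> * real k * (F i z - F i w + L / 2 * (norm (w - z))\<^sup>2)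
      + \<gamma>\<^sup>2 * L * G * (real k * (real k - 1) / 2) * norm (w - z)"
proof -
  let ?g = "gradient d (F i) w"
  define e where "e = local_step \<gamma> w k - (w - (\<gamma> * real k) *\<^sub>R ?g)"
  have "inner (local_step \<gamma> w k - w) (w - z) = \<gamma> * real k * inner ?g (z - w) + inner e (w - z)"
    by (simp add: e_def inner_diff_left inner_diff_right inner_add_left algebra_simps)
  also have "\<dots> \<le> \<gamma> * real k * (F i z - F i w + L / 2 * (norm (w - z))\<^sup>2) + norm e * norm (w - z)"
  proof (intro add_mono mult_left_mono norm_cauchy_schwarz)
    show "inner ?g (z - w) \<le> F i z - F i w + L / 2 * (norm (w - z))\<^sup>2"
      using smooth_quadratic_lower_bound[OF smooth[OF i] lipschitz_gradient[OF i] w z]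
      by (simp add: norm_minus_commute)
  qed (use \<gamma> in auto)
  also have "norm e * norm (w - z) \<le> \<gamma>\<^sup>2 * L * G * (real k * (real k - 1) / 2) * norm (w - z)"
    using local_step_drift[OF w \<gamma>, of k] by (intro mult_right_mono) (auto simp: e_def)
  finally show ?thesis by simp
qed

end

section \<open>Aggregation on the server and descent in one round\<close>

definition server_update :: "real \<Rightarrow> nat \<Rightarrow> nat set \<Rightarrow> (nat \<Rightarrow> real) \<Rightarrow> finseq \<Rightarrow> finseq"
  where "server_update \<gamma> \<tau> S \<pi> w = (\<Sum>i\<in>S. \<pi> i *\<^sub>R local_iterate 0 \<gamma> (gradient d (F i)) w \<tau>)"

lemma server_update_in_Rd: "S \<subseteq> {1..n} \<Longrightarrow> w \<in> Rd d \<Longrightarrow> server_update \<gamma> \<tau> S \<pi> w \<in> Rd d"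
  unfolding server_update_def
  by (intro subspace_sum subspace_Rd subspace_scale local_step_in_Rd) auto

lemma server_update_diff:
  "\<pi> \<in> capped_simplex \<theta> S \<Longrightarrow>
    server_update \<gamma> \<tau> S \<pi> w - w = (\<Sum>i\<in>S. \<pi> i *\<^sub>R (local_iterate 0 \<gamma> (gradient d (F i)) w \<tau> - w))"
  by (simp add: server_update_def scaleR_diff_right sum_subtractf capped_simplexD(2) flip: scaleR_sum_left)

lemma server_update_dist:
  assumes S: "S \<subseteq> {1..n}" and \<pi>: "\<pi> \<in> capped_simplex \<theta> S" and w: "w \<in> Rd d" and \<gamma>: "0 \<le> \<gamma>"
  shows "norm (server_update \<gamma> \<tau> S \<pi> w - w) \<le> \<gamma> * real \<tau> * G"
proof -
  have "norm (server_update \<gamma> \<tau> S \<pi> w - w) \<le>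
      (\<Sum>i\<in>S. \<pi> i * norm (local_iterate 0 \<gamma> (gradient d (F i)) w \<tau> - w))"
    unfolding server_update_diff[OF \<pi>]
    by (rule order_trans[OF norm_sum]) (simp add: capped_simplexD(1)[OF \<pi>])
  also have "\<dots> \<le> \<gamma> * real \<tau> * G"
    using S by (intro weighted_mean_le[OF \<pi>] local_step_dist[OF _ w \<gamma>]) auto
  finally show ?thesis .
qed

text \<open>This is the weak subgradient inequality for the maximal loss, with drift. As
  \<open>\<pi>\<close> is maximal at \<open>w\<close>, its weighted loss there equals the maximal
  loss, while at \<open>z\<close> the weighted loss is at most the maximal one.\<close>

lemma inner_server_update_le:
  assumes S: "S \<in> set_pmf (client_sampling n m)" and w: "w \<in> Rd d" and z: "z \<in> Rd d" and \<gamma>: "0 \<le> \<gamma>"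
    and \<pi>: "is_arg_max (weighted_loss F S w) (\<lambda>\<pi>. \<pi> \<in> capped_simplex \<theta> S) \<pi>"
  shows "inner (server_update \<gamma> \<tau> S \<pi> w - w) (w - z) \<le>
    \<gamma> * real \<tau> * (max_loss \<theta> F S z - max_loss \<theta> F S w + L / 2 * (norm (w - z))\<^sup>2)
      + \<gamma>\<^sup>2 * L * G * (real \<tau> * (real \<tau> - 1) / 2) * norm (w - z)"
proof -
  let ?\<eta> = "\<gamma> * real \<tau>" and ?D = "norm (w - z)"
  let ?E = "\<gamma>\<^sup>2 * L * G * (real \<tau> * (real \<tau> - 1) / 2) * ?D"
  have in_simplex: "\<pi> \<in> capped_simplex \<theta> S"
    and max: "\<And>\<pi>'. \<pi>' \<in> capped_simplex \<theta> S \<Longrightarrow> weighted_loss F S w \<pi>' \<le> weighted_loss F S w \<pi>"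
    using \<pi> unfolding is_arg_max_linorder by auto
  let ?x = "\<lambda>i. local_iterate 0 \<gamma> (gradient d (F i)) w \<tau>"
  have "inner (server_update \<gamma> \<tau> S \<pi> w - w) (w - z) = (\<Sum>i\<in>S. \<pi> i * inner (?x i - w) (w - z))"
    by (simp add: server_update_diff[OF in_simplex] inner_sum_left)
  also have "\<dots> \<le> (\<Sum>i\<in>S. \<pi> i * (?\<eta> * (F i z - F i w + L / 2 * ?D\<^sup>2) + ?E))"
    using inner_local_step_le[OF _ w z \<gamma>] capped_simplexD(1)[OF in_simplex] clientsD(1)[OF S]
    by (intro sum_mono mult_left_mono) auto
  also have "\<dots> = (\<Sum>i\<in>S. ?\<eta> * (\<pi> i * F i z) - ?\<eta> * (\<pi> i * F i w) + \<pi> i * (?\<eta> * (L / 2 * ?D\<^sup>2) + ?E))"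
    by (intro sum.cong refl) (simp add: algebra_simps)
  also have "\<dots> = ?\<eta> * weighted_loss F S z \<pi> - ?\<eta> * weighted_loss F S w \<pi> + (?\<eta> * (L / 2 * ?D\<^sup>2) + ?E)"
    unfolding weighted_loss_def sum.distrib sum_subtractf sum_distrib_left[symmetric]
      sum_distrib_right[symmetric] capped_simplexD(2)[OF in_simplex] by simp
  also have "\<dots> \<le> ?\<eta> * max_loss \<theta> F S z - ?\<eta> * max_loss \<theta> F S w + (?\<eta> * (L / 2 * ?D\<^sup>2) + ?E)"
    using \<gamma> weighted_loss_le_max_loss[OF S in_simplex z] max_loss_le[OF S max]
    by (intro add_right_mono, intro diff_mono mult_left_mono) auto
  finally show ?thesis by (simp add: algebra_simps)
qed

text \<open>The envelope at the new point is tested with \<open>z = prox w\<close>. Expanding the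
  square around \<open>w\<close> yields an inner product, which gives the descent, and the squared
  step length.\<close>

lemma expectation_server_update_le:
  assumes w: "w \<in> Rd d" and \<gamma>: "0 \<le> \<gamma>"
    and \<pi>: "\<And>S. S \<in> set_pmf (client_sampling n m) \<Longrightarrow>
      is_arg_max (weighted_loss F S w) (\<lambda>\<pi>. \<pi> \<in> capped_simplex \<theta> S) (\<pi> S)"
  shows "measure_pmf.expectation (client_sampling n m) (\<lambda>S. envelope (server_update \<gamma> \<tau> S (\<pi> S) w)) \<le>
    envelope w - \<gamma> * real \<tau> / 4 * gradient_sq w +
    (\<gamma> * real \<tau> * (\<gamma> * (real \<tau> - 1) * L * G)\<^sup>2 / 4 + L * (\<gamma> * real \<tau> * G)\<^sup>2)"
proof -
  define z where "z = prox w"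
  define D where "D = norm (w - z)"
  have z: "z \<in> Rd d" by (simp add: z_def prox_in)
  let ?\<eta> = "\<gamma> * real \<tau>" and ?\<E> = "measure_pmf.expectation (client_sampling n m)"
  let ?E = "\<gamma>\<^sup>2 * L * G * (real \<tau> * (real \<tau> - 1) / 2) * D"
  have "envelope (server_update \<gamma> \<tau> S (\<pi> S) w) \<le> envelope w + L * (?\<eta> * G)\<^sup>2 +
      2 * L * (?\<eta> * (max_loss \<theta> F S z - max_loss \<theta> F S w + L / 2 * D\<^sup>2) + ?E)"
    if S: "S \<in> set_pmf (client_sampling n m)" for S
  proof -
    define v where "v = server_update \<gamma> \<tau> S (\<pi> S) w"
    have simplex: "\<pi> S \<in> capped_simplex \<theta> S" using \<pi>[OF S] by (simp add: is_arg_max_def)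
    have "(norm (v - w))\<^sup>2 \<le> (?\<eta> * G)\<^sup>2"
      using server_update_dist[OF clientsD(1)[OF S] simplex w \<gamma>] by (intro power_mono) (auto simp: v_def)
    then have 1: "L * (norm (v - w))\<^sup>2 \<le> L * (?\<eta> * G)\<^sup>2" using L_pos by simp
    have 2: "2 * L * inner (v - w) (w - z) \<le>
        2 * L * (?\<eta> * (max_loss \<theta> F S z - max_loss \<theta> F S w + L / 2 * D\<^sup>2) + ?E)"
      using inner_server_update_le[OF S w z \<gamma> \<pi>[OF S]] L_pos unfolding v_def D_def
      by (intro mult_left_mono) auto
    have "(norm (v - z))\<^sup>2 = (norm (w - z))\<^sup>2 + 2 * inner (v - w) (w - z) + (norm (v - w))\<^sup>2"
      by (simp add: power2_norm_eq_inner inner_diff_left inner_diff_right inner_commute)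
    then have "penalized v z = penalized w z + 2 * L * inner (v - w) (w - z) + L * (norm (v - w))\<^sup>2"
      by (simp only: distrib_left)
    then show ?thesis
      using envelope_le[OF z, of v] 1 2 envelope_eq[of w] unfolding v_def z_def by linarith
  qed
  \<comment> \<open>As \<open>z\<close> and \<open>D\<close> do not depend on the sample, the
    expectation turns the maximal losses into mean losses.\<close>
  from expectation_clients_mono[OF this]
  have "?\<E> (\<lambda>S. envelope (server_update \<gamma> \<tau> S (\<pi> S) w)) \<le> envelope w + L * (?\<eta> * G)\<^sup>2 +
      2 * L * (?\<eta> * (mean_loss z - mean_loss w + L / 2 * D\<^sup>2) + ?E)"
    by (simp add: mean_max_loss_def)
  \<comment> \<open>Quadratic growth at \<open>w\<close> gives
    \<open>mean_loss z - mean_loss w \<le> - 3 / 2 * L * D\<^sup>2\<close>; weak convexity uses up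
    \<open>L / 2 * D\<^sup>2\<close> of this.\<close>
  moreover have "2 * L * (?\<eta> * (mean_loss z - mean_loss w + L / 2 * D\<^sup>2)) \<le> 2 * L * (?\<eta> * (- (L * D\<^sup>2)))"
    using penalized_ge[OF w, of w] L_pos \<gamma> envelope_eq[of w]
    by (intro mult_left_mono) (auto simp: z_def D_def)
  \<comment> \<open>Young's inequality spends half of the available descent
    \<open>2 * \<eta> * (L * D)\<^sup>2\<close> on the drift; the other half is the gradient term of
    the claim.\<close>
  moreover have "2 * L * ?E \<le> ?\<eta> * (L * D)\<^sup>2 + ?\<eta> * (\<gamma> * (real \<tau> - 1) * L * G)\<^sup>2 / 4"
  proof -
    define y where "y = \<gamma> * (real \<tau> - 1) * L * G"
    have "2 * L * ?E = ?\<eta> * (L * D * y)"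
      by (simp add: y_def power2_eq_square)
    moreover have "0 \<le> ?\<eta> * (L * D - y / 2)\<^sup>2" using \<gamma> by simp
    then have "?\<eta> * (L * D * y) \<le> ?\<eta> * (L * D)\<^sup>2 + ?\<eta> * y\<^sup>2 / 4"
      by (simp add: power2_diff power_divide right_diff_distrib distrib_left)
    ultimately show ?thesis by (simp only: y_def)
  qed
  moreover have "?\<eta> / 4 * gradient_sq w = ?\<eta> * (L * D)\<^sup>2"
    by (simp add: gradient_sq_eq[OF w] D_def z_def power_mult_distrib)
  moreover have "2 * L * (?\<eta> * (- (L * D\<^sup>2))) = - 2 * (?\<eta> * (L * D)\<^sup>2)"
    by (simp add: power2_eq_square)
  ultimately show ?thesis
    unfolding distrib_left[of "2 * L" "_ * _" ?E] by linarith
qed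

end

section \<open>The step size\<close>

lemma powr_third_power3: "0 \<le> x \<Longrightarrow> (x powr (1 / 3)) ^ 3 = (x::real)"
  by (cases "x = 0") (auto simp: powr_power)

lemma powr_two_thirds_power3: "0 \<le> x \<Longrightarrow> (x powr (2 / 3)) ^ 3 = (x::real)\<^sup>2"
  by (cases "x = 0") (auto simp: powr_power powr_numeral)

text \<open>With \<open>\<eta> = \<tau> * \<gamma>\<close>, whichever of the three terms attains the minimum controls
  \<open>\<Delta> / (\<eta> * T)\<close>; the other two summands are increasing in \<open>\<eta>\<close>.\<close>
lemma learning_rate_tradeoff:
  fixes \<Delta> L G :: real
  assumes \<tau>: "1 \<le> \<tau>" and T: "1 \<le> T" and L: "0 < L" and G: "0 < G" and \<Delta>: "0 < \<Delta>"
  defines "\<gamma> \<equiv> learning_rate \<tau> T L G \<Delta>" and "\<kappa> \<equiv> 1 - 1 / real \<tau>"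
  shows "0 < \<gamma>"
    and "4 * \<Delta> / (real \<tau> * \<gamma> * real T) + (real \<tau> * \<gamma> * \<kappa> * L * G)\<^sup>2 + 4 * L * (real \<tau> * \<gamma>) * G\<^sup>2 \<le>
      17 * (sqrt (\<Delta> * L * G\<^sup>2 / real T) + (\<Delta> * L * G * \<kappa> powr (1 / 2) / real T) powr (2 / 3)
        + \<Delta> * L / real T)"
proof -
  \<comment> \<open>\<open>a\<close>, \<open>b\<close>, \<open>c\<close> are the three terms of the
    minimum multiplied by \<open>\<tau>\<close>, and \<open>s1\<close>, \<open>s2\<close>,
    \<open>s3\<close> are the three summands of the rate.\<close>
  define a where "a = 1 / (4 * L)"
  define b where "b = sqrt (\<Delta> / (L * G\<^sup>2)) / sqrt (real T)"
  define c where "c = (\<Delta> / (32 * L\<^sup>2 * G\<^sup>2 * \<kappa>)) powr (1 / 3) / real T powr (1 / 3)"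
  define \<eta> where "\<eta> = real \<tau> * \<gamma>"
  define s1 where "s1 = sqrt (\<Delta> * L * G\<^sup>2 / real T)"
  define s2 where "s2 = (\<Delta> * L * G * \<kappa> powr (1 / 2) / real T) powr (2 / 3)"
  define s3 where "s3 = \<Delta> * L / real T"
  have T0: "0 < real T" and \<tau>0: "0 < real \<tau>" using T \<tau> by auto
  have \<kappa>: "0 \<le> \<kappa>" "\<kappa> \<le> 1" using \<tau> by (auto simp: \<kappa>_def field_simps)
  have \<kappa>_pos: "0 < \<kappa>" if "\<tau> \<noteq> 1" using that \<tau> by (auto simp: \<kappa>_def field_simps)
  have a_pos: "0 < a" and b_pos: "0 < b" using L G \<Delta> T0 by (simp_all add: a_def b_def)
  have c_pos: "0 < c" if "\<tau> \<noteq> 1" using \<kappa>_pos[OF that] L G \<Delta> T0 by (simp add: c_def)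
  have s_nonneg: "0 \<le> s1" "0 \<le> s2" "0 \<le> s3"
    using L G \<Delta> T0 by (simp_all add: s1_def s2_def s3_def)
  have min_scale: "real \<tau> * min x y = min (real \<tau> * x) (real \<tau> * y)" for x y
    using \<tau>0 by (simp add: min_mult_distrib_left)
  have \<eta>: "\<eta> = (if \<tau> = 1 then min a b else min a (min b c))"
    using \<tau>0 unfolding \<eta>_def \<gamma>_def learning_rate_def Let_def a_def b_def c_def \<kappa>_def
    by (auto simp only: min_scale if_distrib[of "(*) (real \<tau>)"] split: if_splits) (simp_all add: field_simps)
  have \<eta>_pos: "0 < \<eta>" using \<eta> a_pos b_pos c_pos by auto
  then show "0 < \<gamma>" using \<tau>0 by (simp add: \<eta>_def zero_less_mult_iff)
  have \<eta>_b: "\<eta> \<le> b" and \<eta>_c: "\<tau> \<noteq> 1 \<Longrightarrow> \<eta> \<le> c" using \<eta> by auto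

  \<comment> \<open>\<open>b\<close> balances the step-length error
    \<open>L * \<eta> * G\<^sup>2\<close> against \<open>\<Delta> / (\<eta> * T)\<close>: at
    \<open>\<eta> = b\<close> both equal \<open>s1\<close>.\<close>
  have b: "L * b * G\<^sup>2 = s1" "b * s1 = \<Delta> / real T"
  proof -
    have "b = sqrt (\<Delta> / (L * G\<^sup>2 * real T))"
      by (simp add: b_def real_sqrt_divide[symmetric] mult.assoc)
    moreover have "L * G\<^sup>2 = sqrt ((L * G\<^sup>2)\<^sup>2)" using L by simp
    ultimately have "L * b * G\<^sup>2 = sqrt ((L * G\<^sup>2)\<^sup>2 * (\<Delta> / (L * G\<^sup>2 * real T)))"
      by (metis real_sqrt_mult mult.assoc mult.commute)
    also have "(L * G\<^sup>2)\<^sup>2 * (\<Delta> / (L * G\<^sup>2 * real T)) = \<Delta> * L * G\<^sup>2 / real T"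
      using L G T0 by (simp add: power2_eq_square field_simps)
    finally show 1: "L * b * G\<^sup>2 = s1" by (simp add: s1_def)
    have "(L * G\<^sup>2) * (b * s1) = s1\<^sup>2" using 1 by (simp add: power2_eq_square mult_ac)
    also have "\<dots> = (L * G\<^sup>2) * (\<Delta> / real T)" using L \<Delta> by (simp add: s1_def mult_ac)
    finally show "b * s1 = \<Delta> / real T" unfolding mult_cancel_left using L G by simp
  qed
  \<comment> \<open>Cubing clears the fractional exponents, so that comparisons of \<open>c\<close>
    with \<open>s2\<close> become rational identities.\<close>
  have c3: "c ^ 3 = \<Delta> / (32 * L\<^sup>2 * G\<^sup>2 * \<kappa> * real T)"
    using \<kappa> \<Delta> by (simp add: c_def power_divide powr_third_power3)
  have s2_3: "s2 ^ 3 = \<Delta>\<^sup>2 * L\<^sup>2 * G\<^sup>2 * \<kappa> / (real T)\<^sup>2"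
  proof -
    have "(\<kappa> powr (1 / 2))\<^sup>2 = \<kappa>" using \<kappa> by (simp add: powr_half_sqrt)
    then show ?thesis
      using \<kappa> L G \<Delta> by (simp add: s2_def powr_two_thirds_power3 power_divide power_mult_distrib)
  qed
  have c_s2: "\<Delta> / real T \<le> 4 * c * s2" if "\<tau> \<noteq> 1"
  proof (rule power_le_imp_le_base[of _ 2])
    \<comment> \<open>The factor 2 is \<open>4 ^ 3 / 32\<close>, with 32 from the third term of the
      step size.\<close>
    have "(4 * c * s2) ^ 3 = 2 * (\<Delta> / real T) ^ 3"
      unfolding power_mult_distrib c3 s2_3 using \<kappa>_pos[OF that] L G T0
      by (simp add: power2_eq_square power3_eq_cube field_simps)
    then show "(\<Delta> / real T) ^ Suc 2 \<le> (4 * c * s2) ^ Suc 2"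
      using \<Delta> T0 by (simp del: power_Suc add: numeral_3_eq_3[symmetric])
    show "0 \<le> 4 * c * s2" using c_pos[OF that] s_nonneg by simp
  qed

  have "4 * \<Delta> / (\<eta> * real T) \<le> 16 * s3 + 4 * s1 + 16 * s2"
  proof -
    consider "\<eta> = a" | "\<eta> = b" | "\<tau> \<noteq> 1" "\<eta> = c"
      using \<eta> by (auto simp: min_def split: if_splits)
    then have "\<Delta> / real T \<le> (4 * s3 + s1 + 4 * s2) * \<eta>"
    proof cases
      case 1
      then have "\<Delta> / real T = 4 * s3 * \<eta>" using L by (simp add: a_def s3_def)
      then show ?thesis using s_nonneg \<eta>_pos by (simp add: distrib_right)
    next
      case 2
      then show ?thesis using b(2) s_nonneg \<eta>_pos by (simp add: algebra_simps)
    next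
      case 3
      have "0 \<le> (4 * s3 + s1) * c" using s_nonneg \<eta>_pos 3 by simp
      with c_s2[OF 3(1)] show ?thesis by (simp add: 3(2) algebra_simps)
    qed
    then show ?thesis using \<eta>_pos T0 by (simp add: field_simps)
  qed
  moreover have "(\<eta> * \<kappa> * L * G)\<^sup>2 \<le> s2"
  proof (cases "\<tau> = 1")
    case True
    then show ?thesis using s_nonneg by (simp add: \<kappa>_def)
  next
    case False
    have "(\<eta> * \<kappa> * L * G)\<^sup>2 = \<eta>\<^sup>2 * (\<kappa> * \<kappa>) * (L\<^sup>2 * G\<^sup>2)"
      by (simp add: power_mult_distrib power2_eq_square)
    \<comment> \<open>One factor \<open>\<kappa>\<close> is dropped, as
      \<open>\<kappa> \<le> 1\<close>; the cube of the right-hand side is then exactly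
      \<open>s2 ^ 3 / 32\<^sup>2\<close>.\<close>
    also have "\<dots> \<le> c\<^sup>2 * \<kappa> * (L\<^sup>2 * G\<^sup>2)"
      using \<eta>_pos \<eta>_c[OF False] \<kappa> mult_left_mono[OF \<kappa>(2,1)]
      by (intro mult_right_mono, intro mult_mono power_mono) auto
    also have "\<dots> \<le> s2"
    proof (rule power_le_imp_le_base[of _ 2])
      have "(c\<^sup>2 * \<kappa> * (L\<^sup>2 * G\<^sup>2)) ^ 3 = (c ^ 3)\<^sup>2 * (\<kappa> * (L\<^sup>2 * G\<^sup>2)) ^ 3"
        by (simp add: power_mult_distrib power_commutes flip: power_mult)
      also have "\<dots> = s2 ^ 3 / 1024"
        unfolding c3 s2_3 using \<kappa>_pos[OF False] L G T0
        by (simp add: power2_eq_square power3_eq_cube field_simps)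
      also have "\<dots> \<le> s2 ^ 3" using s_nonneg by simp
      finally show "(c\<^sup>2 * \<kappa> * (L\<^sup>2 * G\<^sup>2)) ^ Suc 2 \<le> s2 ^ Suc 2"
        by (simp del: power_Suc add: numeral_3_eq_3[symmetric])
    qed (rule s_nonneg)
    finally show ?thesis .
  qed
  moreover have "4 * L * \<eta> * G\<^sup>2 \<le> 4 * s1"
    using \<eta>_b L by (simp add: mult_right_mono flip: b(1))
  \<comment> \<open>The three bounds add up to \<open>8 * s1 + 17 * s2 + 16 * s3\<close>, whence the
    constant 17.\<close>
  ultimately show "4 * \<Delta> / (real \<tau> * \<gamma> * real T) + (real \<tau> * \<gamma> * \<kappa> * L * G)\<^sup>2 + 4 * L * (real \<tau> * \<gamma>) * G\<^sup>2 \<le>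
      17 * (sqrt (\<Delta> * L * G\<^sup>2 / real T) + (\<Delta> * L * G * \<kappa> powr (1 / 2) / real T) powr (2 / 3)
        + \<Delta> * L / real T)"
    unfolding \<eta>_def[symmetric] s1_def[symmetric] s2_def[symmetric] s3_def[symmetric]
    using s_nonneg by argo
qed

section \<open>The whole run\<close>

context smooth_losses
begin

context
  fixes \<gamma> :: real and \<tau> T :: nat and sel :: "nat set list \<Rightarrow> nat \<Rightarrow> real" and w0 :: finseq
  assumes \<gamma>: "0 \<le> \<gamma>" and T: "1 \<le> T" and w0: "w0 \<in> Rd d"
    and sel: "selects_maximizers d n m \<theta> F 0 \<gamma> \<tau> T sel w0"
begin

abbreviation run :: "nat set list \<Rightarrow> nat \<Rightarrow> finseq"
  where "run \<equiv> iterate d F 0 \<gamma> \<tau> sel w0"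

abbreviation samples :: "nat \<Rightarrow> nat set list pmf"
  where "samples t \<equiv> replicate_pmf t (client_sampling n m)"

lemma run_Suc: "run Ss (Suc t) = server_update \<gamma> \<tau> (Ss ! t) (sel (take (Suc t) Ss)) (run Ss t)"
  by (simp add: server_update_def)

lemma run_in_Rd: "Ss \<in> set_pmf (samples T') \<Longrightarrow> t \<le> T' \<Longrightarrow> run Ss t \<in> Rd d"
proof (induction t)
  case (Suc t)
  then have "Ss ! t \<in> set_pmf (client_sampling n m)" by (auto simp: set_replicate_pmf)
  then show ?case
    unfolding run_Suc using Suc by (intro server_update_in_Rd clientsD(1)) auto
qed (simp add: w0)

lemma finite_samples: "finite (set_pmf (samples t))"
  by (rule finite_set_replicate_pmf[OF finite_clients])

lemma run_snoc_arg_max: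
  assumes t: "t < T" and Ss: "Ss \<in> set_pmf (samples t)" and S: "S \<in> set_pmf (client_sampling n m)"
  shows "is_arg_max (weighted_loss F S (run Ss t)) (\<lambda>\<pi>. \<pi> \<in> capped_simplex \<theta> S) (sel (Ss @ [S]))"
proof -
  \<comment> \<open>The assumption on \<open>sel\<close> speaks only of sample lists of full length
    \<open>T\<close>, so the history is padded with copies of \<open>S\<close>; by causality the
    padding changes nothing up to round \<open>t\<close>.\<close>
  define Ss' where "Ss' = Ss @ replicate (T - t) S"
  have len: "length Ss = t" using Ss by (simp add: set_replicate_pmf)
  have "Ss' \<in> set_pmf (samples T)"
    using Ss S t by (auto simp: Ss'_def set_replicate_pmf)
  moreover have "Ss' ! t = S" "take (Suc t) Ss' = Ss @ [S]"
    using len t by (simp_all add: Ss'_def nth_append take_Suc_conv_app_nth)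
  moreover have "run Ss' t = run Ss t"
    using len by (simp add: Ss'_def iterate_append)
  ultimately show ?thesis
    using sel t unfolding selects_maximizers_def by metis
qed

definition round_error :: real
  where "round_error = \<gamma> * real \<tau> * (\<gamma> * (real \<tau> - 1) * L * G)\<^sup>2 / 4 + L * (\<gamma> * real \<tau> * G)\<^sup>2"

text \<open>Telescoping of the descent of one round. Given the first \<open>N\<close> samples, the
  iterate is fixed and the next sample is independent, so the bound for one round applies inside the
  outer expectation.\<close>

lemma expected_descent:
  assumes "N \<le> T"
  shows "measure_pmf.expectation (samples N) (\<lambda>Ss. envelope (run Ss N)) +
      \<gamma> * real \<tau> / 4 * (\<Sum>t<N. measure_pmf.expectation (samples t) (\<lambda>Ss. gradient_sq (run Ss t))) \<le>
    envelope w0 + real N * round_error"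
  using assms
proof (induction N)
  case (Suc N)
  have "measure_pmf.expectation (samples (Suc N)) (\<lambda>Ss. envelope (run Ss (Suc N))) =
      measure_pmf.expectation (samples N) (\<lambda>Ss. measure_pmf.expectation (client_sampling n m)
        (\<lambda>S. envelope (run (Ss @ [S]) (Suc N))))"
    unfolding replicate_pmf_snoc
    by (subst integral_bind_pmf_finite) (simp_all add: finite_samples finite_clients)
  also have "\<dots> \<le> measure_pmf.expectation (samples N)
      (\<lambda>Ss. envelope (run Ss N) - \<gamma> * real \<tau> / 4 * gradient_sq (run Ss N) + round_error)"
  proof (rule integral_pmf_mono[OF finite_samples])
    fix Ss assume Ss: "Ss \<in> set_pmf (samples N)"
    then have "length Ss = N" by (simp add: set_replicate_pmf)
    then have "run (Ss @ [S]) (Suc N) = server_update \<gamma> \<tau> S (sel (Ss @ [S])) (run Ss N)" for S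
      unfolding run_Suc by (simp add: iterate_append nth_append)
    then show "measure_pmf.expectation (client_sampling n m) (\<lambda>S. envelope (run (Ss @ [S]) (Suc N))) \<le>
        envelope (run Ss N) - \<gamma> * real \<tau> / 4 * gradient_sq (run Ss N) + round_error"
      using expectation_server_update_le[OF run_in_Rd[OF Ss order_refl] \<gamma> run_snoc_arg_max[OF _ Ss]] Suc.prems
      by (simp only: round_error_def)
  qed
  also have "\<dots> = measure_pmf.expectation (samples N) (\<lambda>Ss. envelope (run Ss N)) -
      \<gamma> * real \<tau> / 4 * measure_pmf.expectation (samples N) (\<lambda>Ss. gradient_sq (run Ss N)) + round_error"
    by (simp add: integrable_measure_pmf_finite[OF finite_samples])
  finally show ?case using Suc by (simp add: algebra_simps)
qed simp

text \<open>The uniform draw of the round becomes an average. By causality each summand needs only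
  the first \<open>t\<close> samples, which matches the form of the descent estimate.\<close>

lemma expectation_output:
  fixes q :: "finseq \<Rightarrow> real"
  shows "measure_pmf.expectation (output_pmf d n m F 0 \<gamma> \<tau> T sel w0) q =
    (\<Sum>t<T. measure_pmf.expectation (samples t) (\<lambda>Ss. q (run Ss t))) / real T"
proof -
  have T0: "{..<T} \<noteq> {}" using T by (auto simp: lessThan_empty_iff)
  have "measure_pmf.expectation (output_pmf d n m F 0 \<gamma> \<tau> T sel w0) q =
      measure_pmf.expectation (samples T) (\<lambda>Ss. (\<Sum>t<T. q (run Ss t)) / real T)"
    unfolding output_pmf_def map_pmf_def[symmetric]
    using T0 by (subst integral_bind_pmf_finite)
      (simp_all add: finite_samples integral_pmf_of_set)
  also have "\<dots> = (\<Sum>t<T. measure_pmf.expectation (samples T) (\<lambda>Ss. q (run Ss t))) / real T"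
    by (simp add: integrable_measure_pmf_finite[OF finite_samples])
  also have "measure_pmf.expectation (samples T) (\<lambda>Ss. q (run Ss t)) =
      measure_pmf.expectation (samples t) (\<lambda>Ss. q (run Ss t))" if "t \<in> {..<T}" for t
  proof -
    have tT: "t \<le> T" using that by simp
    have "measure_pmf.expectation (samples t) (\<lambda>Ss. q (run Ss t)) =
        measure_pmf.expectation (samples T) (\<lambda>Ss. q (run (take t Ss) t))"
      unfolding map_take_replicate_pmf[OF tT, symmetric] by simp
    also have "\<dots> = measure_pmf.expectation (samples T) (\<lambda>Ss. q (run Ss t))"
    proof (rule integral_cong_AE)
      show "AE Ss in samples T. q (run (take t Ss) t) = q (run Ss t)"
        unfolding AE_measure_pmf_iff
      proof
        fix Ss assume "Ss \<in> set_pmf (samples T)"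
        then have "t \<le> length (take t Ss)" using tT by (simp add: set_replicate_pmf)
        from iterate_append[OF this, of d F 0 \<gamma> \<tau> sel w0 "drop t Ss"]
        show "q (run (take t Ss) t) = q (run Ss t)" by (simp only: append_take_drop_id)
      qed
    qed simp_all
    finally show ?thesis by simp
  qed
  then have "(\<Sum>t<T. measure_pmf.expectation (samples T) (\<lambda>Ss. q (run Ss t))) =
      (\<Sum>t<T. measure_pmf.expectation (samples t) (\<lambda>Ss. q (run Ss t)))"
    by (rule sum.cong[OF refl])
  finally show ?thesis .
qed

lemma expected_envelope_ge:
  "(INF v\<in>Rd d. envelope v) \<le> measure_pmf.expectation (samples N) (\<lambda>Ss. envelope (run Ss N))"
  using integral_pmf_mono[OF finite_samples, of N "\<lambda>_. INF v\<in>Rd d. envelope v"]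
    cINF_lower[OF envelope_bdd_below run_in_Rd[OF _ order_refl]] by fastforce

abbreviation gap :: real
  where "gap \<equiv> envelope w0 - (INF v\<in>Rd d. envelope v)"

text \<open>The final expected envelope is at least its infimum, so the telescoped descent bounds
  the sum of the squared gradients; dividing by \<open>\<eta> * T / 4\<close> gives the
  average.\<close>

lemma expected_gradient_sq_le:
  assumes \<tau>: "1 \<le> \<tau>" and pos: "0 < \<gamma>"
  shows "measure_pmf.expectation (output_pmf d n m F 0 \<gamma> \<tau> T sel w0) gradient_sq \<le>
    4 * gap / (real \<tau> * \<gamma> * real T) + (real \<tau> * \<gamma> * (1 - 1 / real \<tau>) * L * G)\<^sup>2
      + 4 * L * (real \<tau> * \<gamma>) * G\<^sup>2"
proof -
  define Q where "Q = (\<Sum>t<T. measure_pmf.expectation (samples t) (\<lambda>Ss. gradient_sq (run Ss t)))"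
  define \<eta> where "\<eta> = real \<tau> * \<gamma>"
  have \<eta>: "0 < \<eta>" using \<tau> pos by (simp add: \<eta>_def)
  have T0: "0 < real T" using T by simp
  have step: "real \<tau> * \<gamma> * (1 - 1 / real \<tau>) = \<gamma> * (real \<tau> - 1)" using \<tau> by (simp add: field_simps)
  have err: "round_error = \<eta> / 4 * ((real \<tau> * \<gamma> * (1 - 1 / real \<tau>) * L * G)\<^sup>2 + 4 * L * \<eta> * G\<^sup>2)"
    unfolding round_error_def \<eta>_def step by (simp add: distrib_left power2_eq_square mult_ac)
  have "\<eta> / 4 * Q \<le> gap + real T * round_error"
    using expected_descent[OF order_refl] expected_envelope_ge[of T]
    by (simp add: Q_def \<eta>_def mult.commute[of \<gamma>])
  then have "Q / real T \<le> 4 * gap / (\<eta> * real T) + round_error * 4 / \<eta>"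
    using \<eta> T0 by (simp add: field_simps)
  also have "round_error * 4 / \<eta> =
      (real \<tau> * \<gamma> * (1 - 1 / real \<tau>) * L * G)\<^sup>2 + 4 * L * \<eta> * G\<^sup>2"
    using \<eta> by (simp add: err)
  finally show ?thesis by (simp add: expectation_output Q_def \<eta>_def)
qed

text \<open>If the gap vanishes, then the step size is \<open>0\<close> and the run stays among the minimizers of
  the envelope.\<close>
lemma expected_gradient_sq_zero_step:
  assumes "\<gamma> = 0" "gap = 0"
  shows "measure_pmf.expectation (output_pmf d n m F 0 \<gamma> \<tau> T sel w0) gradient_sq \<le> 0"
proof -
  have no_error: "round_error = 0" unfolding round_error_def using assms(1) by simp
  have "measure_pmf.expectation (samples t) (\<lambda>Ss. gradient_sq (run Ss t)) \<le> 0" if t: "t < T" for t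
  proof -
    have minimal: "measure_pmf.expectation (samples t) (\<lambda>Ss. envelope (run Ss t)) \<le>
        (INF v\<in>Rd d. envelope v)"
      using expected_descent[of t] t unfolding no_error using assms by simp
    have "measure_pmf.expectation (samples t) (\<lambda>Ss. gradient_sq (run Ss t)) \<le>
        measure_pmf.expectation (samples t)
          (\<lambda>Ss. 4 * L * (envelope (run Ss t) - (INF v\<in>Rd d. envelope v)))"
      by (intro integral_pmf_mono finite_samples gradient_sq_le run_in_Rd[OF _ order_refl])
    also have "\<dots> = 4 * L * (measure_pmf.expectation (samples t) (\<lambda>Ss. envelope (run Ss t)) -
        (INF v\<in>Rd d. envelope v))"
      by (simp add: integrable_measure_pmf_finite[OF finite_samples])
    also have "\<dots> \<le> 0"
      using minimal L_pos by (intro mult_nonneg_nonpos) auto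
    finally show ?thesis .
  qed
  then show ?thesis
    unfolding expectation_output by (intro divide_nonpos_nonneg sum_nonpos) auto
qed

end
end

theorem theorem7:
  shows "\<exists>C0 > (0::real).
    \<forall>(d::nat) (n::nat) (m::nat) (\<tau>::nat) (T::nat) (\<theta>::real) (B::real) (G::real) (L::real)
      (F :: nat \<Rightarrow> finseq \<Rightarrow> real) (w0::finseq) (sel :: nat set list \<Rightarrow> nat \<Rightarrow> real)
      (\<mu>::real) (\<Phi> :: finseq \<Rightarrow> real) (\<Delta>::real) (\<gamma>::real).
      1 \<le> d \<longrightarrow> 1 \<le> m \<longrightarrow> m \<le> n \<longrightarrow> 1 \<le> \<tau> \<longrightarrow> 1 \<le> T \<longrightarrow>
      0 < \<theta> \<longrightarrow> \<theta> < 1 \<longrightarrow> 0 < B \<longrightarrow> 0 < G \<longrightarrow> 0 < L \<longrightarrow>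
      (\<forall>i\<in>{1..n}.
         (\<forall>w\<in>Rd d. 0 \<le> F i w \<and> F i w \<le> B) \<and>
         G-lipschitz_on (Rd d) (F i) \<and>
         continuously_differentiable d (F i) \<and>
         L-lipschitz_on (Rd d) (gradient d (F i))) \<longrightarrow>
      w0 \<in> Rd d \<longrightarrow>
      \<mu> = 2 * L \<longrightarrow>
      \<Phi> = moreau_envelope d \<mu> (mean_max_loss n m \<theta> F) \<longrightarrow>
      \<Delta> = \<Phi> w0 - (INF w\<in>Rd d. \<Phi> w) \<longrightarrow>
      \<gamma> = learning_rate \<tau> T L G \<Delta> \<longrightarrow>
      selects_maximizers d n m \<theta> F 0 \<gamma> \<tau> T sel w0 \<longrightarrow>
      \<Delta> \<le> mean_max_loss n m \<theta> F w0 - (INF w\<in>Rd d. mean_max_loss n m \<theta> F w) \<and>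
      measure_pmf.expectation (output_pmf d n m F 0 \<gamma> \<tau> T sel w0)
          (\<lambda>w. (norm (gradient d \<Phi> w))\<^sup>2)
        \<le> C0 * (sqrt (\<Delta> * L * G\<^sup>2 / real T)
            + (\<Delta> * L * G * (1 - 1 / real \<tau>) powr (1 / 2) / real T) powr (2 / 3)
            + \<Delta> * L / real T)"
proof (intro exI[of _ 17] conjI[of "0 < (17::real)"] allI impI, goal_cases)
  case (2 d n m \<tau> T \<theta> B G L F w0 sel \<mu> \<Phi> \<Delta> \<gamma>)
  interpret smooth_losses d n m \<theta> B G L F
    by unfold_locales (use 2 in auto)
  note [simp] = \<open>\<mu> = 2 * L\<close> \<open>\<Phi> = moreau_envelope d \<mu> (mean_max_loss n m \<theta> F)\<close>
  have \<Delta>: "\<Delta> = envelope w0 - (INF v\<in>Rd d. envelope v)" using 2 by simp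
  have "0 \<le> \<Delta>" using cINF_lower[OF envelope_bdd_below \<open>w0 \<in> Rd d\<close>] by (simp add: \<Delta>)
  \<comment> \<open>For \<open>\<Delta> = 0\<close> the step size is 0 and division by it is
    impossible, hence the separate case.\<close>
  then consider "0 < \<Delta>" | "\<Delta> = 0" by linarith
  then have "measure_pmf.expectation (output_pmf d n m F 0 \<gamma> \<tau> T sel w0) gradient_sq
      \<le> 17 * (sqrt (\<Delta> * L * G\<^sup>2 / real T)
          + (\<Delta> * L * G * (1 - 1 / real \<tau>) powr (1 / 2) / real T) powr (2 / 3)
          + \<Delta> * L / real T)"
  proof cases
    case 1
    note rate = learning_rate_tradeoff[OF \<open>1 \<le> \<tau>\<close> \<open>1 \<le> T\<close> \<open>0 < L\<close> \<open>0 < G\<close> 1,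
        folded \<open>\<gamma> = learning_rate \<tau> T L G \<Delta>\<close>]
    show ?thesis
      using expected_gradient_sq_le[of \<gamma> T w0 \<tau> sel] rate 2 unfolding \<Delta> by linarith
  next
    case zero: 2
    \<comment> \<open>The second term of the minimum is 0 and the other terms are
      nonnegative.\<close>
    then have \<gamma>: "\<gamma> = 0" using \<open>\<gamma> = learning_rate \<tau> T L G \<Delta>\<close> \<open>0 < L\<close>
      by (simp add: learning_rate_def Let_def min_absorb2)
    show ?thesis
      using expected_gradient_sq_zero_step[of \<gamma> T w0 \<tau> sel] \<gamma> 2 zero unfolding \<Delta>[symmetric] by simp
  qed
  then show ?case
    using envelope_gap_le[OF \<open>w0 \<in> Rd d\<close>] by (simp add: \<Delta>)
qed simp

end
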